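(* Let $\mathbf{L}$ be a finite distributive lattice with a direct product decomposition $\mathbf{L}=\prod_{i=1}^n\mathbf{L}_i$, where the $\mathbf{L}_i$ are finite distributive lattices. Then $\mathbf{L}$ is a matchable distributive lattice if and only if each $\mathbf{L}_i$ ($1\le i\le n$) is a matchable distributive lattice.
   Context: A 1-factor is a perfect matching; $\mathcal{M}(G)$ is the set of 1-factors of $G$. Let $G$ be a plane bipartite graph with a fixed proper white/black vertex coloring. For $M\in\mathcal{M}(G)$, a cycle $C$ is $M$-alternating if its edges are alternately in and not in $M$; it is proper (resp. improper) if every edge of $C$ in $M$ goes from white to black (resp. black to white) end-vertex along the clockwise orientation of $C$. The digraph $\vec Z(G)$ has vertex set $\mathcal{M}(G)$ and an arc $M_1\to M_2$ whenever $M_1\oplus M_2$ is the boundary of an inner face of $G$ that is a proper $M_1$-alternating cycle. $\mathbf{M}(G)$ is the poset on $\mathcal{M}(G)$ with $M_1\preceq M_2$ iff $\vec Z(G)$ has a directed path from $M_2$ to $M_1$. A finite distributive lattice $\mathbf{L}$ is called a matchable distributive lattice (MDL) if there is a plane bipartite graph $G$ with $\mathbf{L}\cong\mathbf{M}(G)$. The direct product of posets is ordered componentwise. *)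

theory Defs
  imports "HOL-Complex_Analysis.Winding_Numbers" "HOL-Algebra.Lattice"
begin

subsection \<open>Finite distributive lattices, isomorphism, direct products\<close>

text \<open>Non-emptiness is not part of \<^locale>\<open>lattice\<close> in HOL-Algebra and has to be required.\<close>

locale finite_distributive_lattice = lattice +
  assumes finite_carrier: "finite (carrier L)"
    and carrier_nonempty: "carrier L \<noteq> {}"
    and meet_join_distrib:
      "\<lbrakk>x \<in> carrier L; y \<in> carrier L; z \<in> carrier L\<rbrakk>
        \<Longrightarrow> x \<sqinter> (y \<squnion> z) = (x \<sqinter> y) \<squnion> (x \<sqinter> z)"

definition order_isomorphic :: "'a gorder \<Rightarrow> 'b gorder \<Rightarrow> bool" where
  "order_isomorphic P Q \<longleftrightarrow>
     (\<exists>\<phi>. bij_betw \<phi> (carrier P) (carrier Q) \<and>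
          (\<forall>x\<in>carrier P. \<forall>y\<in>carrier P. x \<sqsubseteq>\<^bsub>P\<^esub> y \<longleftrightarrow> \<phi> x \<sqsubseteq>\<^bsub>Q\<^esub> \<phi> y))"

definition product_order :: "'i set \<Rightarrow> ('i \<Rightarrow> 'a gorder) \<Rightarrow> ('i \<Rightarrow> 'a) gorder" where
  "product_order I P =
     \<lparr>carrier = (\<Pi>\<^sub>E i\<in>I. carrier (P i)),
      eq = (=),
      le = (\<lambda>x y. \<forall>i\<in>I. x i \<sqsubseteq>\<^bsub>P i\<^esub> y i)\<rparr>"

subsection \<open>Plane bipartite graphs\<close>

text \<open>
  Plane graphs are drawn in the complex plane: a vertex is a point, an edge is (the point set of)
  an arc. As no vertex lies in the interior of an edge \<open>e\<close>, the ends of \<open>e\<close> are the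
  elements of \<open>e \<inter> verts G\<close>. The two colour classes are part of the data.
\<close>

record plane_bigraph =
  white :: "complex set"
  black :: "complex set"
  edges :: "complex set set"

definition verts :: "plane_bigraph \<Rightarrow> complex set" where
  "verts G = white G \<union> black G"

definition plane_bipartite_graph :: "plane_bigraph \<Rightarrow> bool" where
  "plane_bipartite_graph G \<longleftrightarrow>
     finite (verts G) \<and> finite (edges G) \<and>
     (\<forall>e\<in>edges G. \<exists>g. arc g \<and> path_image g = e \<and> {pathstart g, pathfinish g} = e \<inter> verts G) \<and>
     (\<forall>e\<in>edges G. \<forall>e'\<in>edges G. e \<noteq> e' \<longrightarrow>
        e \<inter> verts G \<noteq> e' \<inter> verts G \<and> e \<inter> e' \<subseteq> verts G) \<and>
     white G \<inter> black G = {} \<and>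
     (\<forall>e\<in>edges G. e \<inter> white G \<noteq> {} \<and> e \<inter> black G \<noteq> {})"

definition perfect_matchings :: "plane_bigraph \<Rightarrow> complex set set set" where
  "perfect_matchings G = {M. M \<subseteq> edges G \<and> (\<forall>v\<in>verts G. \<exists>!e. e \<in> M \<and> v \<in> e)}"

definition inner_faces :: "plane_bigraph \<Rightarrow> complex set set" where
  "inner_faces G = {f \<in> components (- (verts G \<union> \<Union> (edges G))). bounded f}"

subsection \<open>Cycles and their clockwise orientation\<close>

text \<open>
  A cycle together with a direction of traversal is given by the list \<open>vs\<close> of its vertices and
  the list \<open>es\<close> of its edges, the \<open>i\<close>-th edge leading from the \<open>i\<close>-th vertex to the
  (cyclically) next one.
\<close>

definition is_cycle :: "plane_bigraph \<Rightarrow> complex list \<Rightarrow> complex set list \<Rightarrow> bool" where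
  "is_cycle G vs es \<longleftrightarrow>
     3 \<le> length vs \<and> length es = length vs \<and> distinct vs \<and> set es \<subseteq> edges G \<and>
     (\<forall>i<length vs. es ! i \<inter> verts G = {vs ! i, vs ! (Suc i mod length vs)})"

definition traverses :: "(real \<Rightarrow> complex) \<Rightarrow> complex set \<Rightarrow> complex \<Rightarrow> complex \<Rightarrow> bool" where
  "traverses p e u v \<longleftrightarrow>
     (\<exists>s t. 0 \<le> s \<and> s < t \<and> t \<le> 1 \<and> p ` {s..t} = e \<and> p s = u \<and> p t = v)"

text \<open>The winding number \<open>-1\<close> expresses that the closed curve \<open>p\<close> runs clockwise.\<close>

definition clockwise :: "complex list \<Rightarrow> complex set list \<Rightarrow> bool" where
  "clockwise vs es \<longleftrightarrow>
     (\<exists>p. simple_path p \<and> pathstart p = vs ! 0 \<and> pathfinish p = vs ! 0 \<and>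
          path_image p = \<Union> (set es) \<and>
          (\<forall>i<length vs. traverses p (es ! i) (vs ! i) (vs ! (Suc i mod length vs))) \<and>
          (\<forall>z\<in>inside (path_image p). winding_number p z = -1))"

definition alternating :: "complex set set \<Rightarrow> complex set list \<Rightarrow> bool" where
  "alternating M es \<longleftrightarrow>
     (\<forall>i<length es. es ! i \<in> M \<longleftrightarrow> es ! (Suc i mod length es) \<notin> M)"

definition proper_alternating_cycle ::
    "plane_bigraph \<Rightarrow> complex set set \<Rightarrow> complex set set \<Rightarrow> bool" where
  "proper_alternating_cycle G M C \<longleftrightarrow>
     (\<exists>vs es. is_cycle G vs es \<and> clockwise vs es \<and> set es = C \<and> alternating M es \<and>
        (\<forall>i<length vs. es ! i \<in> M \<longrightarrow>
           vs ! i \<in> white G \<and> vs ! (Suc i mod length vs) \<in> black G))"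

subsection \<open>The Z-transformation digraph and matchable distributive lattices\<close>

definition Z_digraph :: "plane_bigraph \<Rightarrow> (complex set set \<times> complex set set) set" where
  "Z_digraph G =
     {(M\<^sub>1, M\<^sub>2). M\<^sub>1 \<in> perfect_matchings G \<and> M\<^sub>2 \<in> perfect_matchings G \<and>
        (\<exists>f\<in>inner_faces G. frontier f = \<Union> (sym_diff M\<^sub>1 M\<^sub>2)) \<and>
        proper_alternating_cycle G M\<^sub>1 (sym_diff M\<^sub>1 M\<^sub>2)}"

definition matching_poset :: "plane_bigraph \<Rightarrow> complex set set gorder" where
  "matching_poset G =
     \<lparr>carrier = perfect_matchings G,
      eq = (=),
      le = (\<lambda>M\<^sub>1 M\<^sub>2. (M\<^sub>2, M\<^sub>1) \<in> (Z_digraph G)\<^sup>*)\<rparr>"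

definition matchable_distributive_lattice :: "'a gorder \<Rightarrow> bool" where
  "matchable_distributive_lattice L \<longleftrightarrow>
     finite_distributive_lattice L \<and>
     (\<exists>G. plane_bipartite_graph G \<and> order_isomorphic L (matching_poset G))"

end

theory Submission
  imports Defs
begin

text \<open>
  Orient every edge from white to black. The sum over the edges of a matching of their (fractional)
  winding numbers around a point \<open>z\<close> off the drawing is a height function: flipping a face
  raises the height by 1 at the points of that face and changes nothing elsewhere. It shows that
  arcs of the digraph are covers and that two faces that can be flipped in the same matching have
  disjoint boundaries, so that their flips commute.

  Drawing graphs far apart realises the product of their posets. Conversely, suppose the matching
  poset of \<open>G\<close> is a product \<open>A \<times> B\<close>. Every flip moves one coordinate only, its cycle
  does not depend on the other coordinate, and cycles moving \<open>A\<close> are disjoint from cycles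
  moving \<open>B\<close>. Hence the matchings of the subgraph \<open>H\<close> formed by all edges on cycles moving
  \<open>A\<close> correspond to the elements of \<open>A\<close>. A face of \<open>H\<close> may contain edges of \<open>G\<close>;
  that flipping it nevertheless goes down in \<open>A\<close> follows from the existence of joins.
\<close>

subsection \<open>Winding numbers along proper cycles\<close>


text \<open>A clockwise proper cycle runs through its matching edges from white to black and through
  its other edges from black to white. Exchanging the two kinds therefore changes the sum over the
  matching by minus the winding number of the cycle: by 1 inside and by 0 outside. Heights thus
  never decrease along a directed path, and comparing two heights at a point tells whether the face
  there still has to be flipped. The order of a product says nothing by itself about cycles. The
  link is the cover property: it turns comparabilities between levels into single flips, and squares
  of commuting flips then identify the cycles. The least elements of \<open>A\<close> and
  \<open>B\<close> serve as base levels that every descending path can reach. The obstacle is that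
  deleting edges merges faces, so an arc of the subgraph may switch a cycle of \<open>G\<close> that
  encloses other edges and is not an arc of \<open>Z_digraph G\<close>. Only the comparability of
  the two matchings can be hoped for, and a minimality argument on their least upper bound supplies
  it.\<close>

lemma winding_number_arc_cong:
  fixes g h :: "real \<Rightarrow> complex"
  assumes g: "arc g" and h: "arc h" and im: "path_image h = path_image g"
    and st: "pathstart h = pathstart g" and fi: "pathfinish h = pathfinish g"
    and z: "z \<notin> path_image g"
  shows "winding_number h z = winding_number g z"
proof -
  obtain k where k: "homeomorphism {0..1} (path_image g) g k"
    using homeomorphism_arc[OF g] by blast
  \<comment> \<open>As \<open>k\<close> inverts \<open>g\<close>, the path \<open>h\<close> is
    \<open>g\<close> reparametrised by \<open>\<phi>\<close>, which fixes 0 and 1. This gives a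
    homotopy inside the arc, hence away from \<open>z\<close>.\<close>
  define \<phi> where "\<phi> = k \<circ> h"
  have kg: "k (g t) = t" if "t \<in> {0..1}" for t
    using k that by (simp add: homeomorphism_def)
  have gk: "g (k x) = x" if "x \<in> path_image g" for x
    using k that by (simp add: homeomorphism_def)
  have kim: "k ` path_image g = {0..1}"
    using k by (simp add: homeomorphism_def)
  have him: "h t \<in> path_image g" if "t \<in> {0..1}" for t
    using im that by (auto simp: path_image_def)
  have "continuous_on {0..1} \<phi>"
    unfolding \<phi>_def
  proof (rule continuous_on_compose)
    show "continuous_on {0..1} h"
      using h by (simp add: arc_def path_def)
    show "continuous_on (h ` {0..1}) k"
      using k im by (simp add: homeomorphism_def path_image_def)
  qed
  moreover have "\<phi> \<in> {0..1} \<rightarrow> {0..1}"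
    using him kim by (force simp: \<phi>_def)
  moreover have "\<phi> 0 = 0" "\<phi> 1 = 1"
    using st fi kg[of 0] kg[of 1] by (auto simp: \<phi>_def pathstart_def pathfinish_def)
  moreover have "h t = g (\<phi> t)" if "t \<in> {0..1}" for t
    using gk him that by (simp add: \<phi>_def)
  ultimately have "homotopic_paths (- {z}) g h"
    using z g by (intro homotopic_paths_reparametrize[where f = \<phi>]) (auto simp: arc_imp_path)
  then show ?thesis
    using winding_number_homotopic_paths by metis
qed

section \<open>Edges as white-to-black arcs and the winding number of a cycle\<close>

definition support :: "plane_bigraph \<Rightarrow> complex set" where
  "support G = verts G \<union> \<Union> (edges G)"

lemma edge_is_arc:
  assumes "plane_bipartite_graph G" "e \<in> edges G"
  shows "\<exists>g. arc g \<and> path_image g = e \<and> pathstart g \<in> white G \<and> pathfinish g \<in> black G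
    \<and> {pathstart g, pathfinish g} = e \<inter> verts G"
proof -
  from assms obtain g where g: "arc g" "path_image g = e" "{pathstart g, pathfinish g} = e \<inter> verts G"
    and wb: "white G \<inter> black G = {}" "e \<inter> white G \<noteq> {}" "e \<inter> black G \<noteq> {}"
    unfolding plane_bipartite_graph_def by meson
  have "pathstart g \<in> white G \<union> black G" "pathfinish g \<in> white G \<union> black G"
    "e \<inter> white G \<subseteq> {pathstart g, pathfinish g}" "e \<inter> black G \<subseteq> {pathstart g, pathfinish g}"
    using g(3) unfolding verts_def by auto
  then have "pathstart g \<in> white G \<and> pathfinish g \<in> black G \<or>
        pathstart g \<in> black G \<and> pathfinish g \<in> white G"
    using wb by auto
  then show ?thesis
  proof
    assume "pathstart g \<in> white G \<and> pathfinish g \<in> black G"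
    then show ?thesis using g by blast
  next
    assume "pathstart g \<in> black G \<and> pathfinish g \<in> white G"
    then show ?thesis
      using g by (intro exI[of _ "reversepath g"]) (auto simp: arc_reversepath)
  qed
qed

text \<open>One parametrisation per edge is fixed once and for all; by
  \<open>winding_number_arc_cong\<close> the choice does not influence winding numbers around points
  off the edge.\<close>

definition edge_path :: "plane_bigraph \<Rightarrow> complex set \<Rightarrow> real \<Rightarrow> complex" where
  "edge_path G e = (SOME g. arc g \<and> path_image g = e \<and> pathstart g \<in> white G \<and> pathfinish g \<in> black G
    \<and> {pathstart g, pathfinish g} = e \<inter> verts G)"

lemma edge_path:
  assumes "plane_bipartite_graph G" "e \<in> edges G"
  shows "arc (edge_path G e)" "path_image (edge_path G e) = e"
    "pathstart (edge_path G e) \<in> white G" "pathfinish (edge_path G e) \<in> black G"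
    "{pathstart (edge_path G e), pathfinish (edge_path G e)} = e \<inter> verts G"
  using someI_ex[OF edge_is_arc[OF assms]] unfolding edge_path_def by blast+

text \<open>\<open>traverses\<close> yields one parameter interval per edge, with no relation
  between the intervals. Since \<open>p\<close> repeats a value only at 0 and 1 and the vertices are
  distinct, each interval must end where the next begins, and together they fill
  \<open>{0..1}\<close>.\<close>

lemma simple_path_traversed_edges:
  assumes p: "simple_path p" "pathstart p = vs ! 0" "pathfinish p = vs ! 0"
    and vs: "distinct vs" "2 \<le> length vs"
    and tr: "\<forall>i<length vs. traverses p (es ! i) (vs ! i) (vs ! (Suc i mod length vs))"
  obtains s where "s 0 = 0" "s (length vs) = 1" "\<forall>i\<le>length vs. s i \<in> {0..1}"
    "\<forall>i<length vs. s i < s (Suc i) \<and> p ` {s i..s (Suc i)} = es ! i \<and> p (s i) = vs ! i"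
proof -
  let ?n = "length vs"
  obtain a b where ab: "\<forall>i<?n. 0 \<le> a i \<and> a i < b i \<and> b i \<le> 1 \<and> p ` {a i..b i} = es ! i \<and>
      p (a i) = vs ! i \<and> p (b i) = vs ! (Suc i mod ?n)"
    using tr unfolding traverses_def by metis
  have inj: "x = y \<or> x = 0 \<and> y = 1 \<or> x = 1 \<and> y = 0"
    if "x \<in> {0..1}" "y \<in> {0..1}" "p x = p y" for x y
    using p(1) that unfolding simple_path_def loop_free_def by blast
  have p01: "p 0 = vs ! 0" "p 1 = vs ! 0"
    using p by (auto simp: pathstart_def pathfinish_def)
  have n0: "0 < ?n"
    using vs(2) by linarith
  have a0: "a 0 = 0"
    using ab[rule_format, OF n0] inj[of "a 0" 0] p01 by auto
  have bl: "b (?n - 1) = 1"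
  proof -
    have l: "?n - 1 < ?n"
      using n0 by simp
    have "p (b (?n - 1)) = vs ! 0"
      using ab[rule_format, OF l] n0 by simp
    then show ?thesis
      using ab[rule_format, OF l] inj[of "b (?n - 1)" 0] p01 by auto
  qed
  have ba: "b i = a (Suc i)" if "Suc i < ?n" for i
  proof -
    have i: "i < ?n"
      using that by simp
    have "p (b i) = vs ! Suc i" "p (a (Suc i)) = vs ! Suc i"
      using ab[rule_format, OF i] ab[rule_format, OF that] that by auto
    moreover have "vs ! Suc i \<noteq> vs ! 0"
      using vs(1) that n0 by (simp add: nth_eq_iff_index_eq)
    ultimately show ?thesis
      using inj[of "b i" "a (Suc i)"] ab[rule_format, OF i] ab[rule_format, OF that] p01 by auto
  qed
  define s where "s i = (if i < ?n then a i else 1)" for i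
  have sSuc: "s (Suc i) = b i" if "i < ?n" for i
  proof (cases "Suc i < ?n")
    case True
    then show ?thesis using ba by (simp add: s_def)
  next
    case False
    then have "i = ?n - 1"
      using that by simp
    then show ?thesis using bl False by (simp add: s_def)
  qed
  show thesis
  proof (rule that)
    show "s 0 = 0" "s ?n = 1"
      using n0 a0 by (simp_all add: s_def)
    show "\<forall>i\<le>?n. s i \<in> {0..1}"
      using ab by (force simp: s_def)
    show "\<forall>i<?n. s i < s (Suc i) \<and> p ` {s i..s (Suc i)} = es ! i \<and> p (s i) = vs ! i"
      using ab sSuc by (simp add: s_def)
  qed
qed

text \<open>The winding number of the boundary curve is the sum over its edge pieces. An edge in
  \<open>M\<close> is run through in the direction of \<open>edge_path\<close>, any other edge
  backwards, which accounts for the minus sign. The total is -1 inside and 0 outside.\<close>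

lemma winding_number_proper_cycle:
  assumes G: "plane_bipartite_graph G" and C: "proper_alternating_cycle G M C" and z: "z \<notin> \<Union> C"
  shows "(\<Sum>e\<in>C \<inter> M. Re (winding_number (edge_path G e) z)) -
         (\<Sum>e\<in>C - M. Re (winding_number (edge_path G e) z)) = - indicat_real (inside (\<Union> C)) z"
proof -
  from C obtain vs es where cyc: "is_cycle G vs es" and cl: "clockwise vs es" and C_eq: "set es = C"
    and alt: "alternating M es"
    and wb_M: "\<forall>i<length vs. es ! i \<in> M \<longrightarrow> vs ! i \<in> white G \<and> vs ! (Suc i mod length vs) \<in> black G"
    unfolding proper_alternating_cycle_def by blast
  let ?n = "length vs"
  have n: "3 \<le> ?n" and les: "length es = ?n" and dist: "distinct vs" and sub: "set es \<subseteq> edges G"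
    and ends: "\<forall>i<?n. es ! i \<inter> verts G = {vs ! i, vs ! (Suc i mod ?n)}"
    using cyc unfolding is_cycle_def by auto
  from cl obtain p where p: "simple_path p" "pathstart p = vs ! 0" "pathfinish p = vs ! 0"
    and pim: "path_image p = \<Union> C"
    and tr: "\<forall>i<?n. traverses p (es ! i) (vs ! i) (vs ! (Suc i mod ?n))"
    and wn: "\<forall>z\<in>inside (path_image p). winding_number p z = -1"
    unfolding clockwise_def C_eq by blast
  obtain s where s: "s 0 = 0" "s ?n = 1" "\<forall>i\<le>?n. s i \<in> {0..1}"
    "\<forall>i<?n. s i < s (Suc i) \<and> p ` {s i..s (Suc i)} = es ! i \<and> p (s i) = vs ! i"
    using simple_path_traversed_edges[OF p dist _ tr] n by auto
  have wb: "white G \<inter> black G = {}"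
    using G unfolding plane_bipartite_graph_def by blast
  have zp: "z \<notin> path_image p"
    using z pim by simp
  have path: "path p"
    using p(1) by (rule simple_path_imp_path)
  have psn: "p (s (Suc i)) = vs ! (Suc i mod ?n)" if "i < ?n" for i
  proof (cases "Suc i < ?n")
    case True
    then show ?thesis using s(4) by simp
  next
    case False
    then have "Suc i = ?n"
      using that by simp
    then show ?thesis using s(2) p(3) by (simp add: pathfinish_def)
  qed
  have edge: "es ! i \<in> edges G" if "i < ?n" for i
    using sub les that by (metis nth_mem subsetD)
  define col where "col i = (if es ! i \<in> M then vs ! i \<in> white G \<and> vs ! (Suc i mod ?n) \<in> black G
      else vs ! i \<in> black G \<and> vs ! (Suc i mod ?n) \<in> white G)" for i
  have col: "col i" if i: "i < ?n" for i
  proof (cases "es ! i \<in> M")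
    case True
    then show ?thesis using wb_M i by (simp add: col_def)
  next
    case False
    let ?j = "Suc i mod ?n"
    have j: "?j < ?n"
      using i by (intro mod_less_divisor) linarith
    \<comment> \<open>Properness speaks of edges in \<open>M\<close> only. An edge not in
      \<open>M\<close> is followed by one in \<open>M\<close>, whose start is white; so the given
      edge ends in a white vertex and starts in a black one.\<close>
    have "es ! ?j \<in> M"
      using alt False i les unfolding alternating_def by auto
    then have w: "vs ! ?j \<in> white G"
      using wb_M j by blast
    have "es ! i \<inter> black G \<noteq> {}"
      using G edge[OF i] unfolding plane_bipartite_graph_def by blast
    then have "vs ! i \<in> black G"
      using ends[rule_format, OF i] w wb unfolding verts_def by blast
    then show ?thesis
      using w False by (simp add: col_def)
  qed
  define \<sigma> where "\<sigma> e = (if e \<in> M then 1 else -1 :: complex)" for e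
  have piece: "winding_number (subpath (s i) (s (Suc i)) p) z =
      \<sigma> (es ! i) * winding_number (edge_path G (es ! i)) z" if i: "i < ?n" for i
  proof -
    let ?q = "subpath (s i) (s (Suc i)) p" and ?g = "edge_path G (es ! i)"
    have si: "s i \<in> {0..1}" "s (Suc i) \<in> {0..1}" "s i < s (Suc i)"
      using s i by auto
    have "vs ! i \<noteq> vs ! (Suc i mod ?n)"
      using col[OF i] wb unfolding col_def by (auto split: if_splits)
    then have arcq: "arc ?q"
      using arc_simple_path_subpath[OF p(1) si(1,2)] s(4) i psn[OF i] by simp
    have imq: "path_image ?q = es ! i"
      using path_image_subpath[of "s i" "s (Suc i)" p] si s(4) i by simp
    have stq: "pathstart ?q = vs ! i" "pathfinish ?q = vs ! (Suc i mod ?n)"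
      using s(4) i psn[OF i] by auto
    note g = edge_path[OF G edge[OF i]]
    have gends: "{pathstart ?g, pathfinish ?g} = {vs ! i, vs ! (Suc i mod ?n)}"
      using g(5) ends i by simp
    have ze: "z \<notin> es ! i"
      using z C_eq les i nth_mem by fastforce
    show ?thesis
    proof (cases "es ! i \<in> M")
      case True
      then have "pathstart ?g = vs ! i" "pathfinish ?g = vs ! (Suc i mod ?n)"
        using col[OF i] gends g(3,4) wb unfolding col_def by (auto simp: doubleton_eq_iff)
      then show ?thesis
        using winding_number_arc_cong[OF g(1) arcq] imq stq g(2) ze True by (simp add: \<sigma>_def)
    next
      case False
      then have e: "pathfinish ?g = vs ! i" "pathstart ?g = vs ! (Suc i mod ?n)"
        using col[OF i] gends g(3,4) wb unfolding col_def by (auto simp: doubleton_eq_iff)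
      have "winding_number ?q z = winding_number (reversepath ?g) z"
        using winding_number_arc_cong[of "reversepath ?g" ?q] e arcq imq stq g(1,2) ze
        by (simp add: arc_reversepath)
      also have "\<dots> = - winding_number ?g z"
        using winding_number_reversepath[of ?g z] g(1,2) ze by (simp add: arc_imp_path)
      finally show ?thesis
        using False by (simp add: \<sigma>_def)
    qed
  qed
  have sum: "winding_number (subpath 0 (s m) p) z =
      (\<Sum>i<m. \<sigma> (es ! i) * winding_number (edge_path G (es ! i)) z)" if "m \<le> ?n" for m
    using that
  proof (induction m)
    case 0
    have "p 0 \<noteq> z"
      using zp by (auto simp: path_image_def)
    then show ?case
      using s(1) winding_number_trivial[of z "p 0"] by (simp add: subpath_refl linepath_refl)
  next
    case (Suc m)
    have "winding_number (subpath 0 (s (Suc m)) p) z =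
        winding_number (subpath 0 (s m) p) z + winding_number (subpath (s m) (s (Suc m)) p) z"
      using Suc.prems s(3) by (intro winding_number_subpath_combine[OF path zp, symmetric]) auto
    then show ?case
      using Suc piece by simp
  qed
  \<comment> \<open>Equal edges have the same pair of ends, and membership in \<open>M\<close> fixes
    which end comes first; so they start at the same vertex, and the vertices are distinct.\<close>
  have dist_es: "distinct es"
    unfolding distinct_conv_nth les
  proof (intro allI impI notI)
    fix i j
    assume ij: "i < ?n" "j < ?n" "i \<noteq> j" "es ! i = es ! j"
    then have "{vs ! i, vs ! (Suc i mod ?n)} = {vs ! j, vs ! (Suc j mod ?n)}"
      using ends by metis
    then have "vs ! i = vs ! j"
      using col[OF ij(1)] col[OF ij(2)] ij(4) wb unfolding col_def
      by (auto split: if_splits simp: doubleton_eq_iff)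
    then show False
      using dist ij by (simp add: nth_eq_iff_index_eq)
  qed
  have "winding_number p z = (\<Sum>e\<in>C. \<sigma> e * winding_number (edge_path G e) z)"
  proof -
    have "bij_betw (\<lambda>i. es ! i) {..<?n} C"
      using bij_betw_nth[OF dist_es] les C_eq by auto
    then have "(\<Sum>i<?n. \<sigma> (es ! i) * winding_number (edge_path G (es ! i)) z) =
        (\<Sum>e\<in>C. \<sigma> e * winding_number (edge_path G e) z)"
      by (rule sum.reindex_bij_betw)
    then show ?thesis
      using sum[of ?n] s(2) by simp
  qed
  then have "Re (winding_number p z) = (\<Sum>e\<in>C. Re (\<sigma> e * winding_number (edge_path G e) z))"
    by simp
  also have "\<dots> = (\<Sum>e\<in>C \<inter> M. Re (winding_number (edge_path G e) z)) -
         (\<Sum>e\<in>C - M. Re (winding_number (edge_path G e) z))"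
  proof -
    have "finite C"
      using C_eq by auto
    then have "(\<Sum>e\<in>C. Re (\<sigma> e * winding_number (edge_path G e) z)) =
        (\<Sum>e\<in>C \<inter> M. Re (\<sigma> e * winding_number (edge_path G e) z)) +
        (\<Sum>e\<in>C - M. Re (\<sigma> e * winding_number (edge_path G e) z))"
      by (subst sum.union_disjoint[symmetric]) (auto intro: sum.cong)
    then show ?thesis
      by (simp add: \<sigma>_def sum_negf)
  qed
  finally have eq: "(\<Sum>e\<in>C \<inter> M. Re (winding_number (edge_path G e) z)) -
         (\<Sum>e\<in>C - M. Re (winding_number (edge_path G e) z)) = Re (winding_number p z)"
    by simp
  show ?thesis
  proof (cases "z \<in> inside (\<Union> C)")
    case True
    then show ?thesis
      using eq wn pim by simp
  next
    case False
    then have "z \<in> outside (path_image p)"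
      using zp pim by (simp add: outside_inside)
    then have "winding_number p z = 0"
      using p path by (intro winding_number_zero_in_outside) auto
    then show ?thesis
      using eq False by simp
  qed
qed

subsection \<open>The height function\<close>


lemma proper_cycle_subset_edges:
  "proper_alternating_cycle G M C \<Longrightarrow> C \<subseteq> edges G"
  unfolding proper_alternating_cycle_def is_cycle_def by blast

lemma proper_cycle_closed_path:
  assumes "proper_alternating_cycle G M C"
  obtains p where "simple_path p" "pathfinish p = pathstart p" "path_image p = \<Union> C"
  using assms unfolding proper_alternating_cycle_def clockwise_def by metis

lemma proper_cycle_inside:
  assumes "proper_alternating_cycle G M C"
  shows "inside (\<Union> C) \<noteq> {}" "connected (inside (\<Union> C))" "bounded (inside (\<Union> C))"
    "frontier (inside (\<Union> C)) = \<Union> C" "inside (\<Union> C) \<in> components (- \<Union> C)"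
proof -
  obtain p where p: "simple_path p" "pathfinish p = pathstart p" "path_image p = \<Union> C"
    using proper_cycle_closed_path[OF assms] .
  note J = Jordan_inside_outside[OF p(1,2), unfolded p(3)]
  show "inside (\<Union> C) \<noteq> {}" "connected (inside (\<Union> C))" "bounded (inside (\<Union> C))"
    "frontier (inside (\<Union> C)) = \<Union> C"
    using J by auto
  have "closed (\<Union> C)"
    using p by (metis closed_simple_path_image)
  then show "inside (\<Union> C) \<in> components (- \<Union> C)"
    using J by (simp add: inside_in_components)
qed

text \<open>Only the membership in the matching of the edges on the cycle matters, so a flip can be
  carried over to any matching that looks the same along the cycle.\<close>

lemma proper_cycle_cong:
  assumes "M \<inter> C = M' \<inter> C"
  shows "proper_alternating_cycle G M C \<longleftrightarrow> proper_alternating_cycle G M' C"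
proof -
  have *: "proper_alternating_cycle G M' C"
    if MM: "M \<inter> C = M' \<inter> C" and C: "proper_alternating_cycle G M C" for M M'
  proof -
    from C obtain vs es where cyc: "is_cycle G vs es" and cl: "clockwise vs es" and C_eq: "set es = C"
      and alt: "alternating M es"
      and wb: "\<forall>i<length vs. es ! i \<in> M \<longrightarrow> vs ! i \<in> white G \<and> vs ! (Suc i mod length vs) \<in> black G"
      unfolding proper_alternating_cycle_def by blast
    have les: "length es = length vs"
      using cyc unfolding is_cycle_def by auto
    have mem: "es ! i \<in> M \<longleftrightarrow> es ! i \<in> M'" if "i < length vs" for i
    proof -
      have "es ! i \<in> C"
        using C_eq les that by auto
      then show ?thesis
        using MM by auto
    qed
    have "Suc i mod length vs < length vs" if "i < length vs" for i
      using that by (intro mod_less_divisor) linarith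
    then have "alternating M' es"
      using alt mem les unfolding alternating_def by metis
    moreover have "\<forall>i<length vs. es ! i \<in> M' \<longrightarrow> vs ! i \<in> white G \<and> vs ! (Suc i mod length vs) \<in> black G"
      using wb mem by blast
    ultimately show ?thesis
      using cyc cl C_eq unfolding proper_alternating_cycle_def by blast
  qed
  show ?thesis
    using *[of M M'] *[of M' M] assms by blast
qed

section \<open>Bounded faces as interiors of cycles\<close>

lemma in_components_of_subset:
  assumes "X \<in> components S" "X \<subseteq> T" "T \<subseteq> S"
  shows "X \<in> components T"
proof -
  have X: "X \<noteq> {}" "connected X" "\<And>Y. Y \<noteq> {} \<Longrightarrow> X \<subseteq> Y \<Longrightarrow> Y \<subseteq> S \<Longrightarrow> connected Y \<Longrightarrow> Y = X"
    using assms(1) by (simp_all add: in_components_maximal)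
  have "Y = X" if "Y \<noteq> {} \<and> X \<subseteq> Y \<and> Y \<subseteq> T \<and> connected Y" for Y
    using that assms(3) X(3)[of Y] by auto
  then show ?thesis
    using assms(2) X(1,2) by (simp add: in_components_maximal)
qed

text \<open>A connected set that contains \<open>f\<close> and avoids the frontier \<open>K\<close>
  of \<open>f\<close> cannot leave \<open>f\<close>. So \<open>f\<close> is a component of the
  complement of \<open>K\<close> as well; being bounded it meets \<open>inside K\<close>, which is
  also a component.\<close>

lemma bounded_component_eq_inside:
  assumes f: "f \<in> components U" "bounded f" and fr: "frontier f = K" and K: "U \<subseteq> - K"
    and in_c: "inside K \<in> components (- K)"
  shows "f = inside K"
proof -
  have f': "f \<noteq> {}" "f \<subseteq> U" "connected f"
    using f(1) by (simp_all add: in_components_maximal)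
  have "f \<in> components (- K)"
    unfolding in_components_maximal
  proof (intro conjI allI impI)
    fix d assume d: "d \<noteq> {} \<and> f \<subseteq> d \<and> d \<subseteq> - K \<and> connected d"
    then have "d - f = {}"
      using connected_Int_frontier[of d f] fr f'(1) by blast
    then show "d = f"
      using d by blast
  qed (use f' K in auto)
  moreover obtain x where x: "x \<in> f"
    using f' by blast
  moreover have "x \<in> inside K"
  proof -
    have "connected_component_set (- K) x = f"
      using \<open>f \<in> components (- K)\<close> x by (metis components_iff connected_component_eq)
    moreover have "x \<notin> K"
      using x f' K by blast
    ultimately show ?thesis
      using f(2) by (simp add: inside_def)
  qed
  ultimately show ?thesis
    using components_nonoverlap[of f "- K" "inside K"] in_c by blast
qed

lemma cycle_face_component:
  assumes C: "proper_alternating_cycle G M C" and "inside (\<Union> C) \<inter> support G = {}"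
  shows "inside (\<Union> C) \<in> components (- support G)"
  using assms proper_cycle_subset_edges[OF C]
  by (intro in_components_of_subset[OF proper_cycle_inside(5)[OF C]]) (auto simp: support_def)

text \<open>Because a face is a component of the complement of the whole drawing, an arc of the digraph
  is a flip along a cycle whose interior avoids the drawing; faces need not be mentioned.\<close>

lemma Z_digraph_iff:
  "(M\<^sub>1, M\<^sub>2) \<in> Z_digraph G \<longleftrightarrow>
     M\<^sub>1 \<in> perfect_matchings G \<and> M\<^sub>2 \<in> perfect_matchings G \<and>
     proper_alternating_cycle G M\<^sub>1 (sym_diff M\<^sub>1 M\<^sub>2) \<and>
     inside (\<Union> (sym_diff M\<^sub>1 M\<^sub>2)) \<inter> support G = {}"
proof -
  let ?C = "sym_diff M\<^sub>1 M\<^sub>2"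
  have "(\<exists>f\<in>inner_faces G. frontier f = \<Union> ?C) \<longleftrightarrow> inside (\<Union> ?C) \<inter> support G = {}"
    if C: "proper_alternating_cycle G M\<^sub>1 ?C"
  proof
    assume "\<exists>f\<in>inner_faces G. frontier f = \<Union> ?C"
    then obtain f where f: "f \<in> components (- support G)" "bounded f" "frontier f = \<Union> ?C"
      unfolding inner_faces_def support_def by blast
    have "f = inside (\<Union> ?C)"
      using proper_cycle_subset_edges[OF C]
      by (intro bounded_component_eq_inside[OF f _ proper_cycle_inside(5)[OF C]])
        (auto simp: support_def)
    then show "inside (\<Union> ?C) \<inter> support G = {}"
      using in_components_subset[OF f(1)] by blast
  next
    assume "inside (\<Union> ?C) \<inter> support G = {}"
    then show "\<exists>f\<in>inner_faces G. frontier f = \<Union> ?C"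
      using cycle_face_component[OF C] proper_cycle_inside[OF C]
      unfolding inner_faces_def support_def by blast
  qed
  then show ?thesis
    unfolding Z_digraph_def by auto
qed

lemma Z_arcD:
  assumes "(M\<^sub>1, M\<^sub>2) \<in> Z_digraph G"
  shows "M\<^sub>1 \<in> perfect_matchings G" "M\<^sub>2 \<in> perfect_matchings G"
    "proper_alternating_cycle G M\<^sub>1 (sym_diff M\<^sub>1 M\<^sub>2)"
    "inside (\<Union> (sym_diff M\<^sub>1 M\<^sub>2)) \<inter> support G = {}"
  using assms unfolding Z_digraph_iff by blast+

section \<open>Recovering matching edges and edge sets from points\<close>

lemma perfect_matching_subset: "M \<in> perfect_matchings G \<Longrightarrow> M \<subseteq> edges G"
  by (simp add: perfect_matchings_def)

lemma perfect_matching_edge: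
  "M \<in> perfect_matchings G \<Longrightarrow> v \<in> verts G \<Longrightarrow> \<exists>e\<in>M. v \<in> e"
  by (fastforce simp: perfect_matchings_def)

lemma perfect_matching_unique:
  "M \<in> perfect_matchings G \<Longrightarrow> v \<in> verts G \<Longrightarrow> e \<in> M \<Longrightarrow> e' \<in> M \<Longrightarrow> v \<in> e \<Longrightarrow> v \<in> e' \<Longrightarrow> e = e'"
  by (auto simp: perfect_matchings_def)

text \<open>If the edge of \<open>M\<close> at \<open>v\<close> also belonged to \<open>M'\<close>,
  it would be the only edge of either matching at \<open>v\<close>, and no edge of the symmetric
  difference could reach \<open>v\<close>.\<close>

lemma moved_vertex_edge:
  assumes M: "M \<in> perfect_matchings G" "M' \<in> perfect_matchings G"
    and v: "v \<in> verts G" "v \<in> \<Union> (sym_diff M M')"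
  obtains e where "e \<in> M" "e \<notin> M'" "v \<in> e"
proof -
  obtain e where e: "e \<in> M" "v \<in> e"
    using perfect_matching_edge M(1) v(1) by blast
  have "e \<notin> M'"
  proof
    assume "e \<in> M'"
    then show False
      using v e perfect_matching_unique[OF M(1) v(1)] perfect_matching_unique[OF M(2) v(1)] by blast
  qed
  then show thesis
    using that e by blast
qed

text \<open>Different edges share only vertices, and the midpoint of an injective parametrisation is
  not an end, hence not a vertex.\<close>

lemma edge_interior_point:
  assumes G: "plane_bipartite_graph G" and e: "e \<in> edges G"
  obtains x where "x \<in> e" "\<And>e'. e' \<in> edges G \<Longrightarrow> x \<in> e' \<Longrightarrow> e' = e"
proof -
  note g = edge_path[OF G e]
  let ?x = "edge_path G e (1/2)"
  have "inj_on (edge_path G e) {0..1}"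
    using g(1) by (simp add: arc_def)
  then have "?x \<notin> {pathstart (edge_path G e), pathfinish (edge_path G e)}"
    unfolding pathstart_def pathfinish_def by (auto dest: inj_onD)
  moreover have x: "?x \<in> e"
    using g(2) unfolding path_image_def by force
  ultimately have nv: "?x \<notin> verts G"
    using g(5) by blast
  have "e' = e" if "e' \<in> edges G" "?x \<in> e'" for e'
    using G e that x nv unfolding plane_bipartite_graph_def by blast
  with x show thesis
    using that by blast
qed

text \<open>The frontier of a face is only a set of points; this recovers from it the edges of the
  boundary cycle.\<close>

lemma edge_sets_eqI:
  assumes G: "plane_bipartite_graph G" and "S \<subseteq> edges G" "T \<subseteq> edges G" "\<Union> S = \<Union> T"
  shows "S = T"
proof -
  have *: "S \<subseteq> T" if sub: "S \<subseteq> edges G" "T \<subseteq> edges G" "\<Union> S \<subseteq> \<Union> T" for S T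
  proof
    fix e assume e: "e \<in> S"
    obtain x where x: "x \<in> e" "\<And>e'. e' \<in> edges G \<Longrightarrow> x \<in> e' \<Longrightarrow> e' = e"
      using edge_interior_point[OF G subsetD[OF sub(1) e]] by blast
    obtain e' where "e' \<in> T" "x \<in> e'"
      using x(1) e sub(3) by blast
    then show "e \<in> T"
      using x(2) sub(2) by blast
  qed
  show ?thesis
    using *[of S T] *[of T S] assms by auto
qed

text \<open>Both interiors are components of the complement of the drawing. Sharing \<open>z\<close>
  they coincide, and so do their frontiers. A flip is thus determined by any single point of its
  face.\<close>

lemma face_cycles_eqI:
  assumes G: "plane_bipartite_graph G"
    and C: "proper_alternating_cycle G M C" "inside (\<Union> C) \<inter> support G = {}"
    and D: "proper_alternating_cycle G N D" "inside (\<Union> D) \<inter> support G = {}"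
    and z: "z \<in> inside (\<Union> C)" "z \<in> inside (\<Union> D)"
  shows "C = D"
proof -
  have "inside (\<Union> C) = inside (\<Union> D)"
    using cycle_face_component[OF C] cycle_face_component[OF D] z
    by (metis components_nonoverlap disjoint_iff)
  then have "\<Union> C = \<Union> D"
    using proper_cycle_inside(4)[OF C(1)] proper_cycle_inside(4)[OF D(1)] by metis
  then show ?thesis
    using edge_sets_eqI[OF G] proper_cycle_subset_edges C(1) D(1) by metis
qed

section \<open>Heights along directed paths\<close>

text \<open>For an open arc the real part of the winding number is the total change of angle around
  \<open>z\<close> divided by \<open>2 * pi\<close>. The individual summands need not be
  integers.\<close>

definition height :: "plane_bigraph \<Rightarrow> complex set set \<Rightarrow> complex \<Rightarrow> real" where
  "height G M z = (\<Sum>e\<in>M. Re (winding_number (edge_path G e) z))"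

text \<open>The cycle need not bound a face. Besides arcs of the digraph this covers cycles that
  enclose further edges, which is how \<open>proper_cycle_switch_le\<close> uses it.\<close>

lemma height_diff:
  assumes G: "plane_bipartite_graph G" and M: "M\<^sub>1 \<subseteq> edges G" "M\<^sub>2 \<subseteq> edges G"
    and C: "proper_alternating_cycle G M\<^sub>1 (sym_diff M\<^sub>1 M\<^sub>2)" and z: "z \<notin> support G"
  shows "height G M\<^sub>2 z = height G M\<^sub>1 z + indicat_real (inside (\<Union> (sym_diff M\<^sub>1 M\<^sub>2))) z"
proof -
  have fin: "finite M\<^sub>1" "finite M\<^sub>2"
    using G M unfolding plane_bipartite_graph_def by (meson finite_subset)+
  let ?w = "\<lambda>e. Re (winding_number (edge_path G e) z)"
  have "z \<notin> \<Union> (sym_diff M\<^sub>1 M\<^sub>2)"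
    using z M by (auto simp: support_def)
  moreover have "sym_diff M\<^sub>1 M\<^sub>2 \<inter> M\<^sub>1 = M\<^sub>1 - M\<^sub>2" "sym_diff M\<^sub>1 M\<^sub>2 - M\<^sub>1 = M\<^sub>2 - M\<^sub>1"
    by auto
  ultimately have "sum ?w (M\<^sub>1 - M\<^sub>2) - sum ?w (M\<^sub>2 - M\<^sub>1) =
    - indicat_real (inside (\<Union> (sym_diff M\<^sub>1 M\<^sub>2))) z"
    using winding_number_proper_cycle[OF G C] by metis
  moreover have "sum ?w M\<^sub>1 = sum ?w (M\<^sub>1 - M\<^sub>2) + sum ?w (M\<^sub>1 \<inter> M\<^sub>2)"
    "sum ?w M\<^sub>2 = sum ?w (M\<^sub>2 - M\<^sub>1) + sum ?w (M\<^sub>1 \<inter> M\<^sub>2)"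
    using sum.Int_Diff[OF fin(1), of ?w "M\<^sub>2"] sum.Int_Diff[OF fin(2), of ?w "M\<^sub>1"]
    by (simp_all add: Int_commute)
  ultimately show ?thesis
    unfolding height_def by linarith
qed

lemma height_arc:
  assumes "plane_bipartite_graph G" "(M\<^sub>1, M\<^sub>2) \<in> Z_digraph G" "z \<notin> support G"
  shows "height G M\<^sub>2 z = height G M\<^sub>1 z + indicat_real (inside (\<Union> (sym_diff M\<^sub>1 M\<^sub>2))) z"
  using height_diff[OF assms(1) _ _ Z_arcD(3)[OF assms(2)] assms(3)] Z_arcD(1,2)[OF assms(2)]
  by (simp add: perfect_matching_subset)

lemma height_mono:
  assumes G: "plane_bipartite_graph G" and "(M\<^sub>1, M\<^sub>2) \<in> (Z_digraph G)\<^sup>*" and z: "z \<notin> support G"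
  shows "height G M\<^sub>1 z \<le> height G M\<^sub>2 z"
  using assms(2)
proof (induction rule: rtrancl_induct)
  case (step N N')
  then show ?case
    using height_arc[OF G step(2) z] by (simp add: indicator_def split: if_splits)
qed simp

lemma height_strict:
  assumes G: "plane_bipartite_graph G" and a: "(M\<^sub>1, M\<^sub>2) \<in> Z_digraph G"
    and "(M\<^sub>2, M\<^sub>3) \<in> (Z_digraph G)\<^sup>*" and z: "z \<in> inside (\<Union> (sym_diff M\<^sub>1 M\<^sub>2))"
  shows "height G M\<^sub>1 z < height G M\<^sub>3 z"
proof -
  have zs: "z \<notin> support G"
    using Z_arcD(4)[OF a] z by blast
  show ?thesis
    using height_mono[OF G assms(3) zs] height_arc[OF G a zs] z by simp
qed

lemma Z_arc_face_point:
  assumes "(M\<^sub>1, M\<^sub>2) \<in> Z_digraph G"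
  obtains z where "z \<in> inside (\<Union> (sym_diff M\<^sub>1 M\<^sub>2))" "z \<notin> support G"
proof -
  have "inside (\<Union> (sym_diff M\<^sub>1 M\<^sub>2)) \<noteq> {}"
    using Z_arcD(3)[OF assms] by (rule proper_cycle_inside(1))
  then obtain z where z: "z \<in> inside (\<Union> (sym_diff M\<^sub>1 M\<^sub>2))"
    by blast
  moreover from z have "z \<notin> support G"
    using Z_arcD(4)[OF assms] by blast
  ultimately show thesis
    using that by blast
qed

text \<open>The flip to \<open>M'\<close> raises the height at the points of its face, and the rest
  of the path cannot undo this. But the arc to \<open>N\<close> raises the height only in its own
  face, so both flips use the same face.\<close>

lemma Z_arc_first_step:
  assumes G: "plane_bipartite_graph G" and a: "(M, N) \<in> Z_digraph G"
    and b: "(M, M') \<in> Z_digraph G" and c: "(M', N) \<in> (Z_digraph G)\<^sup>*"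
  shows "M' = N"
proof -
  obtain z where z: "z \<in> inside (\<Union> (sym_diff M M'))" "z \<notin> support G"
    using Z_arc_face_point[OF b] .
  have "height G M z < height G N z"
    using height_strict[OF G b c z(1)] .
  then have "z \<in> inside (\<Union> (sym_diff M N))"
    using height_arc[OF G a z(2)] by (auto simp: indicator_def split: if_splits)
  then have "sym_diff M M' = sym_diff M N"
    using face_cycles_eqI[OF G Z_arcD(3,4)[OF b] Z_arcD(3,4)[OF a] z(1)] by blast
  then show ?thesis
    by blast
qed

text \<open>Returning to \<open>M\<close> after a flip would make the height of \<open>M\<close> at
  a point of the flipped face smaller than itself.\<close>

lemma Z_rtrancl_antisym:
  assumes G: "plane_bipartite_graph G" and "(M, N) \<in> (Z_digraph G)\<^sup>*" "(N, M) \<in> (Z_digraph G)\<^sup>*"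
  shows "M = N"
  using assms(2)
proof (cases rule: converse_rtranclE)
  case (step M')
  then have M': "(M', M) \<in> (Z_digraph G)\<^sup>*"
    using assms(3) by (meson rtrancl_trans)
  obtain z where "z \<in> inside (\<Union> (sym_diff M M'))"
    using Z_arc_face_point[OF step(1)] .
  then show ?thesis
    using height_strict[OF G step(1) M'] by auto
qed

lemma Z_arc_cover:
  assumes G: "plane_bipartite_graph G" and a: "(M, N) \<in> Z_digraph G"
    and "(M, X) \<in> (Z_digraph G)\<^sup>*" "(X, N) \<in> (Z_digraph G)\<^sup>*"
  shows "X = M \<or> X = N"
  using assms(3)
proof (cases rule: converse_rtranclE)
  case (step M')
  then have "M' = N"
    using Z_arc_first_step[OF G a step(1)] assms(4) by (meson rtrancl_trans)
  then show ?thesis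
    using Z_rtrancl_antisym[OF G] step(2) assms(4) by blast
qed simp

subsection \<open>Commuting flips\<close>


text \<open>The height of a matching may jump only across its own edges; this is what makes an edge
  absent from two matchings invisible to the difference of their heights.\<close>

lemma height_isCont:
  assumes G: "plane_bipartite_graph G" and M: "M \<subseteq> edges G" and x: "x \<notin> \<Union> M"
  shows "isCont (height G M) x"
  unfolding height_def
proof (intro continuous_sum continuous_Re)
  fix e assume e: "e \<in> M"
  then show "isCont (winding_number (edge_path G e)) x"
    using edge_path(1,2)[OF G subsetD[OF M e]] x
    by (intro continuous_at_winding_number) (auto simp: arc_imp_path)
qed

text \<open>An edge shared by two faces would be traversed by both boundary cycles in the same direction.
  The height difference of the two flipped matchings does not involve this edge, so it is continuous
  at its inner points, but it is \<open>-1\<close> on one face and \<open>1\<close> on the other.\<close>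

lemma Z_arcs_disjoint:
  assumes G: "plane_bipartite_graph G"
    and a: "(M, M\<^sub>1) \<in> Z_digraph G" and b: "(M, M\<^sub>2) \<in> Z_digraph G" and ne: "M\<^sub>1 \<noteq> M\<^sub>2"
  shows "\<Union> (sym_diff M M\<^sub>1) \<inter> \<Union> (sym_diff M M\<^sub>2) = {}"
proof (rule ccontr)
  let ?C = "sym_diff M M\<^sub>1" and ?D = "sym_diff M M\<^sub>2"
  assume "\<Union> ?C \<inter> \<Union> ?D \<noteq> {}"
  then obtain x c d where c: "c \<in> ?C" "x \<in> c" and d: "d \<in> ?D" "x \<in> d"
    by blast
  note A = Z_arcD[OF a] and B = Z_arcD[OF b]
  have cd: "c \<in> edges G" "d \<in> edges G"
    using c(1) d(1) proper_cycle_subset_edges[OF A(3)] proper_cycle_subset_edges[OF B(3)] by auto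
  \<comment> \<open>A common point of the two boundaries is traded for a common vertex, because
    vertices are where uniqueness of matching edges can be applied.\<close>
  have "\<exists>v\<in>verts G. v \<in> c \<and> v \<in> d"
  proof (cases "c = d")
    case True
    then show ?thesis
      using edge_path(5)[OF G cd(1)] by blast
  next
    case False
    then have "c \<inter> d \<subseteq> verts G"
      using G cd unfolding plane_bipartite_graph_def by simp
    then show ?thesis
      using c d by blast
  qed
  then obtain v where v: "v \<in> verts G" "v \<in> c" "v \<in> d"
    by blast
  have vC: "v \<in> \<Union> ?C" and vD: "v \<in> \<Union> ?D"
    using c(1) d(1) v by (meson UnionI)+
  obtain e where e: "e \<in> M" "e \<notin> M\<^sub>1" "v \<in> e"
    using moved_vertex_edge[OF A(1,2) v(1) vC] .
  obtain e' where e': "e' \<in> M" "e' \<notin> M\<^sub>2" "v \<in> e'"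
    using moved_vertex_edge[OF B(1,2) v(1) vD] .
  \<comment> \<open>Each flip removes the edge of \<open>M\<close> at \<open>v\<close>, and there is
    only one. So the two cycles share not just \<open>v\<close> but the edge
    \<open>e\<close>.\<close>
  have "e' = e"
    using perfect_matching_unique[OF A(1) v(1)] e e' by simp
  with e' have e2: "e \<notin> M\<^sub>2"
    by simp
  have sub: "M \<subseteq> edges G" "M\<^sub>1 \<subseteq> edges G" "M\<^sub>2 \<subseteq> edges G"
    using A B perfect_matching_subset by auto
  obtain y where y: "y \<in> e" "\<And>e'. e' \<in> edges G \<Longrightarrow> y \<in> e' \<Longrightarrow> e' = e"
    using edge_interior_point[OF G subsetD[OF sub(1) e(1)]] by blast
  have yM: "y \<notin> \<Union> M\<^sub>1" "y \<notin> \<Union> M\<^sub>2"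
    using y(2) e(2) e2 sub by auto
  define h where "h z = height G M\<^sub>2 z - height G M\<^sub>1 z" for z
  have "isCont h y"
    unfolding h_def using height_isCont[OF G sub(2) yM(1)] height_isCont[OF G sub(3) yM(2)]
    by (intro continuous_diff)
  then obtain \<delta> where \<delta>: "\<delta> > 0" "\<And>z. dist z y < \<delta> \<Longrightarrow> dist (h z) (h y) < 1"
    by (metis continuous_at_eps_delta zero_less_one dist_norm)
  have "y \<in> \<Union> ?C" "y \<in> \<Union> ?D"
    using y(1) e(1,2) e2 by blast+
  then have "y \<in> closure (inside (\<Union> ?C))" "y \<in> closure (inside (\<Union> ?D))"
    using proper_cycle_inside(4)[OF A(3)] proper_cycle_inside(4)[OF B(3)]
    by (simp_all add: frontier_def set_eq_iff) blast+
  then obtain z w where z: "z \<in> inside (\<Union> ?C)" "dist z y < \<delta>" and w: "w \<in> inside (\<Union> ?D)" "dist w y < \<delta>"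
    using \<delta>(1) unfolding closure_approachable by metis
  have "?C \<noteq> ?D"
    using ne by blast
  then have zw: "z \<notin> inside (\<Union> ?D)" "w \<notin> inside (\<Union> ?C)"
    using face_cycles_eqI[OF G A(3,4) B(3,4)] z(1) w(1) by blast+
  have "z \<notin> support G" "w \<notin> support G"
    using z(1) w(1) A(4) B(4) by blast+
  then have "h z = -1" "h w = 1"
    using height_arc[OF G a] height_arc[OF G b] z(1) w(1) zw by (simp_all add: h_def del: Union_Un_distrib)
  then show False
    using \<delta>(2)[OF z(2)] \<delta>(2)[OF w(2)] by (simp add: dist_real_def)
qed

text \<open>The two boundaries are disjoint, so either cycle remains proper after the other has been
  flipped. That its interior avoids the drawing does not depend on the matching at all.\<close>

lemma Z_arcs_commute:
  assumes G: "plane_bipartite_graph G"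
    and a: "(M, M\<^sub>1) \<in> Z_digraph G" and b: "(M, M\<^sub>2) \<in> Z_digraph G" and ne: "M\<^sub>1 \<noteq> M\<^sub>2"
  obtains N where "(M\<^sub>1, N) \<in> Z_digraph G" "(M\<^sub>2, N) \<in> Z_digraph G"
    "sym_diff M\<^sub>1 N = sym_diff M M\<^sub>2" "sym_diff M\<^sub>2 N = sym_diff M M\<^sub>1"
proof -
  let ?C = "sym_diff M M\<^sub>1" and ?D = "sym_diff M M\<^sub>2"
  define N where "N = sym_diff M\<^sub>1 ?D"
  note A = Z_arcD[OF a] and B = Z_arcD[OF b]
  have disj: "\<Union> ?C \<inter> \<Union> ?D = {}"
    using Z_arcs_disjoint[OF assms] .
  have sub: "?C \<subseteq> edges G" "?D \<subseteq> edges G"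
    using A(3) B(3) by (auto dest: proper_cycle_subset_edges)
  have "e \<noteq> {}" if "e \<in> edges G" for e
    using edge_path(2)[OF G that] path_image_nonempty by metis
  then have CD: "?C \<inter> ?D = {}"
    using disj sub by blast
  have N_off_D: "e \<in> N \<longleftrightarrow> e \<in> M\<^sub>1" if "e \<notin> ?D" for e
    using that by (auto simp: N_def)
  have N_off_C: "e \<in> N \<longleftrightarrow> e \<in> M\<^sub>2" if "e \<notin> ?C" for e
    using that by (auto simp: N_def)
  have N1: "sym_diff M\<^sub>1 N = ?D"
    by (auto simp: N_def)
  have N2: "sym_diff M\<^sub>2 N = ?C"
    using CD by (auto simp: N_def)
  \<comment> \<open>At a vertex on the second cycle \<open>N\<close> has the same edges as
    \<open>M\<^sub>2\<close>, at any other vertex the same as \<open>M\<^sub>1\<close>.\<close>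
  have N: "N \<in> perfect_matchings G"
  proof -
    have "\<exists>!e. e \<in> N \<and> v \<in> e" if v: "v \<in> verts G" for v
    proof (cases "v \<in> \<Union> ?D")
      case True
      then have "e \<notin> ?C" if "v \<in> e" for e
        using disj that by (metis UnionI disjoint_iff)
      then have "e \<in> N \<and> v \<in> e \<longleftrightarrow> e \<in> M\<^sub>2 \<and> v \<in> e" for e
        using N_off_C by metis
      then show ?thesis
        using B(2) v by (simp add: perfect_matchings_def)
    next
      case False
      then have "e \<in> N \<and> v \<in> e \<longleftrightarrow> e \<in> M\<^sub>1 \<and> v \<in> e" for e
        using N_off_D by (metis UnionI)
      then show ?thesis
        using A(2) v by (simp add: perfect_matchings_def)
    qed
    moreover have "N \<subseteq> edges G"
      using sub A(2) perfect_matching_subset[of "M\<^sub>1" G] unfolding N_def by blast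
    ultimately show ?thesis
      by (simp add: perfect_matchings_def)
  qed
  have "M\<^sub>1 \<inter> ?D = M \<inter> ?D" "M\<^sub>2 \<inter> ?C = M \<inter> ?C"
    using CD by auto
  then have "proper_alternating_cycle G M\<^sub>1 ?D" "proper_alternating_cycle G M\<^sub>2 ?C"
    using A(3) B(3) proper_cycle_cong by metis+
  then have "(M\<^sub>1, N) \<in> Z_digraph G" "(M\<^sub>2, N) \<in> Z_digraph G"
    using A B N by (simp_all only: Z_digraph_iff N1 N2 simp_thms)
  then show thesis
    using that N1 N2 by blast
qed

text \<open>Since the heights at \<open>z\<close> differ, the face at \<open>z\<close> is flipped
  somewhere on the path to \<open>N\<close>. As long as the path flips another face, that flip
  commutes with the flip at \<open>z\<close>; so the latter can be pulled to the front.\<close>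

lemma Z_reach_after_flip:
  assumes G: "plane_bipartite_graph G" and "(J, N) \<in> (Z_digraph G)\<^sup>*"
    and "(J, Y) \<in> Z_digraph G" "z \<in> inside (\<Union> (sym_diff J Y))" "height G J z \<noteq> height G N z"
  shows "(Y, N) \<in> (Z_digraph G)\<^sup>*"
  using assms(2-)
proof (induction arbitrary: Y rule: converse_rtrancl_induct)
  case base
  then show ?case by simp
next
  case (step J J')
  show ?case
  proof (cases "J' = Y")
    case True
    then show ?thesis using step by simp
  next
    case False
    obtain X where X: "(J', X) \<in> Z_digraph G" "(Y, X) \<in> Z_digraph G" "sym_diff J' X = sym_diff J Y"
      using Z_arcs_commute[OF G step(1) step.prems(1) False] by metis
    have zs: "z \<notin> support G"
      using Z_arcD(4)[OF step.prems(1)] step.prems(2) by blast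
    \<comment> \<open>Otherwise the step of the path would flip the face at \<open>z\<close> itself
      and lead to \<open>Y\<close>. Hence the step keeps the height at \<open>z\<close> and the
      induction hypothesis applies to the opposite side of the commuting square.\<close>
    have "z \<notin> inside (\<Union> (sym_diff J J'))"
    proof
      assume "z \<in> inside (\<Union> (sym_diff J J'))"
      then have "sym_diff J J' = sym_diff J Y"
        using face_cycles_eqI[OF G Z_arcD(3,4)[OF step(1)] Z_arcD(3,4)[OF step.prems(1)]]
          step.prems(2) by blast
      then show False
        using False by blast
    qed
    then have "height G J' z = height G J z"
      using height_arc[OF G step(1) zs] by (simp del: Union_Un_distrib)
    then have "(X, N) \<in> (Z_digraph G)\<^sup>*"
      using step.IH[OF X(1)] step.prems(2,3) X(3) by metis
    then show ?thesis
      using X(2) by simp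
  qed
qed

text \<open>If \<open>N\<close> arises from \<open>M\<close> by switching a proper alternating cycle that need not bound a face,
  then every first step from an upper bound \<open>J\<close> towards \<open>M\<close> flips a face that also has to be
  flipped on the way to \<open>N\<close>. Hence the least upper bound is \<open>M\<close>.\<close>

lemma proper_cycle_switch_le:
  assumes G: "plane_bipartite_graph G"
    and M: "M \<in> perfect_matchings G" "N \<in> perfect_matchings G"
    and C: "proper_alternating_cycle G M (sym_diff M N)"
    and J: "(J, M) \<in> (Z_digraph G)\<^sup>*" "(J, N) \<in> (Z_digraph G)\<^sup>*"
    and least: "\<And>K. (K, M) \<in> (Z_digraph G)\<^sup>* \<Longrightarrow> (K, N) \<in> (Z_digraph G)\<^sup>* \<Longrightarrow> (K, J) \<in> (Z_digraph G)\<^sup>*"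
  shows "(M, N) \<in> (Z_digraph G)\<^sup>*"
  using J(1)
proof (cases rule: converse_rtranclE)
  case base
  then show ?thesis using J(2) by simp
next
  case (step Y)
  obtain z where z: "z \<in> inside (\<Union> (sym_diff J Y))" "z \<notin> support G"
    using Z_arc_face_point[OF step(1)] .
  have "height G J z < height G M z"
    using height_strict[OF G step(1,2) z(1)] .
  \<comment> \<open>However many faces the cycle encloses, switching it raises the height inside and
    changes it nowhere else off the drawing. So \<open>N\<close> also lies above \<open>J\<close> in
    height at \<open>z\<close>.\<close>
  also have "\<dots> \<le> height G N z"
    using height_diff[OF G _ _ C z(2)] M perfect_matching_subset by (simp add: indicator_def del: Union_Un_distrib)
  finally have "(Y, N) \<in> (Z_digraph G)\<^sup>*"
    using Z_reach_after_flip[OF G J(2) step(1) z(1)] by simp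
  then have "(Y, J) \<in> (Z_digraph G)\<^sup>*"
    using least step(2) by blast
  then have "height G J z < height G J z"
    using height_strict[OF G step(1) _ z(1)] by blast
  then show ?thesis
    by simp
qed

subsection \<open>Factors of a matching poset\<close>


lemma Z_arc_neq: "plane_bipartite_graph G \<Longrightarrow> (M, N) \<in> Z_digraph G \<Longrightarrow> M \<noteq> N"
  using height_strict Z_arc_face_point by (metis less_irrefl rtrancl.rtrancl_refl)

lemma Z_rtrancl_matching:
  assumes "(M, N) \<in> (Z_digraph G)\<^sup>*"
  shows "M \<in> perfect_matchings G \<longleftrightarrow> N \<in> perfect_matchings G"
  using assms by (induction rule: rtrancl_induct) (auto dest: Z_arcD(1,2))

text \<open>\<open>I\<close> is meant to be a slice of the product, that is, the matchings with one
  coordinate fixed.\<close>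

definition moved_edges :: "plane_bigraph \<Rightarrow> complex set set set \<Rightarrow> complex set set" where
  "moved_edges G I = \<Union> {sym_diff M N | M N. M \<in> I \<and> N \<in> I \<and> (M, N) \<in> Z_digraph G}"

text \<open>The isomorphism in curried form. Directed paths descend, hence the reversed arguments of
  \<open>leA\<close> and \<open>leB\<close>. The roles of the factors are symmetric, and
  \<open>swap\<close> makes every fact about \<open>A\<close> available for
  \<open>B\<close>.\<close>

locale matching_product =
  fixes G :: plane_bigraph
    and A :: "'a set" and leA :: "'a \<Rightarrow> 'a \<Rightarrow> bool" and botA :: 'a
    and B :: "'b set" and leB :: "'b \<Rightarrow> 'b \<Rightarrow> bool" and botB :: 'b
    and \<Phi> :: "'a \<Rightarrow> 'b \<Rightarrow> complex set set"
  assumes G: "plane_bipartite_graph G"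
    and \<Phi>_matching: "a \<in> A \<Longrightarrow> b \<in> B \<Longrightarrow> \<Phi> a b \<in> perfect_matchings G"
    and \<Phi>_surj: "M \<in> perfect_matchings G \<Longrightarrow> \<exists>a\<in>A. \<exists>b\<in>B. M = \<Phi> a b"
    and \<Phi>_inj: "\<lbrakk>a \<in> A; a' \<in> A; b \<in> B; b' \<in> B; \<Phi> a b = \<Phi> a' b'\<rbrakk> \<Longrightarrow> a = a' \<and> b = b'"
    and \<Phi>_le: "\<lbrakk>a \<in> A; a' \<in> A; b \<in> B; b' \<in> B\<rbrakk> \<Longrightarrow>
      (\<Phi> a b, \<Phi> a' b') \<in> (Z_digraph G)\<^sup>* \<longleftrightarrow> leA a' a \<and> leB b' b"
    and botA: "botA \<in> A" "a \<in> A \<Longrightarrow> leA botA a"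
    and botB: "botB \<in> B" "b \<in> B \<Longrightarrow> leB botB b"
begin

lemma swap: "matching_product G B leB botB A leA botA (\<lambda>b a. \<Phi> a b)"
proof
  show "M \<in> perfect_matchings G \<Longrightarrow> \<exists>b\<in>B. \<exists>a\<in>A. M = \<Phi> a b" for M
    using \<Phi>_surj by blast
qed (use G \<Phi>_matching \<Phi>_inj \<Phi>_le botA botB in auto)

lemma reflA: "a \<in> A \<Longrightarrow> leA a a" and reflB: "b \<in> B \<Longrightarrow> leB b b"
  using \<Phi>_le botA(1) botB(1) by blast+

lemma antisymA: "\<lbrakk>a \<in> A; a' \<in> A; leA a a'; leA a' a\<rbrakk> \<Longrightarrow> a = a'"
  by (metis G Z_rtrancl_antisym \<Phi>_inj \<Phi>_le botB(1) reflB)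

lemma antisymB: "\<lbrakk>b \<in> B; b' \<in> B; leB b b'; leB b' b\<rbrakk> \<Longrightarrow> b = b'"
  by (metis G Z_rtrancl_antisym \<Phi>_inj \<Phi>_le botA(1) reflA)

text \<open>The product order supplies a path at level \<open>c\<close>. Its first step keeps the
  level and reaches some \<open>x\<close> between \<open>a'\<close> and \<open>a\<close>. Carried
  back to level \<open>b\<close>, \<open>x\<close> lies between the ends of an arc, and arcs are
  covers; so the first step already reaches \<open>a'\<close>.\<close>

lemma arc_change_level:
  assumes a: "a \<in> A" "a' \<in> A" and b: "b \<in> B" "c \<in> B" and arc: "(\<Phi> a b, \<Phi> a' b) \<in> Z_digraph G"
  shows "(\<Phi> a c, \<Phi> a' c) \<in> Z_digraph G"
proof -
  have le: "leA a' a"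
    using \<Phi>_le[OF a b(1) b(1)] arc by blast
  have "(\<Phi> a c, \<Phi> a' c) \<in> (Z_digraph G)\<^sup>*"
    using \<Phi>_le[OF a b(2) b(2)] le reflB[OF b(2)] by simp
  then show ?thesis
  proof (cases rule: converse_rtranclE)
    case base
    then have "a = a'"
      using \<Phi>_inj a b by blast
    then show ?thesis
      using Z_arc_neq[OF G arc] by simp
  next
    case (step Y)
    obtain x y where xy: "x \<in> A" "y \<in> B" "Y = \<Phi> x y"
      using \<Phi>_surj Z_arcD(2)[OF step(1)] by blast
    have le1: "leA x a" "leB y c"
      using \<Phi>_le[OF a(1) xy(1) b(2) xy(2)] step(1) xy(3) by blast+
    have le2: "leA a' x" "leB c y"
      using \<Phi>_le[OF xy(1) a(2) xy(2) b(2)] step(2) xy(3) by simp_all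
    have y: "y = c"
      using antisymB[OF xy(2) b(2)] le1 le2 by simp
    have "\<Phi> x b = \<Phi> a b \<or> \<Phi> x b = \<Phi> a' b"
      using \<Phi>_le[OF a(1) xy(1) b(1) b(1)] \<Phi>_le[OF xy(1) a(2) b(1) b(1)] le1 le2 reflB[OF b(1)]
      by (intro Z_arc_cover[OF G arc]) simp_all
    then have "x = a \<or> x = a'"
      using \<Phi>_inj xy(1) a b(1) by blast
    then show ?thesis
      using step(1) Z_arc_neq[OF G step(1)] xy(3) y by auto
  qed
qed

text \<open>Commuting the two flips closes a square with a bottom corner \<open>N\<close>. The
  matching \<open>\<Phi> a' b'\<close> lies between \<open>\<Phi> a' b\<close> and \<open>N\<close>,
  which are joined by an arc; so it is \<open>N\<close>, and opposite sides of the square flip the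
  same cycle.\<close>

lemma square:
  assumes a: "a \<in> A" "a' \<in> A" and b: "b \<in> B" "b' \<in> B"
    and A_arc: "(\<Phi> a b, \<Phi> a' b) \<in> Z_digraph G" and B_arc: "(\<Phi> a b, \<Phi> a b') \<in> Z_digraph G"
  shows "sym_diff (\<Phi> a b) (\<Phi> a' b) = sym_diff (\<Phi> a b') (\<Phi> a' b')"
    and "\<Union> (sym_diff (\<Phi> a b) (\<Phi> a' b)) \<inter> \<Union> (sym_diff (\<Phi> a b) (\<Phi> a b')) = {}"
proof -
  have leA: "leA a' a"
    using \<Phi>_le[OF a b(1) b(1)] A_arc by blast
  have leB: "leB b' b"
    using \<Phi>_le[OF a(1) a(1) b] B_arc by blast
  have neA: "a \<noteq> a'" and neB: "b \<noteq> b'"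
    using Z_arc_neq[OF G] A_arc B_arc by blast+
  have ne: "\<Phi> a' b \<noteq> \<Phi> a b'"
    using \<Phi>_inj[OF a(2,1) b] neA by blast
  show "\<Union> (sym_diff (\<Phi> a b) (\<Phi> a' b)) \<inter> \<Union> (sym_diff (\<Phi> a b) (\<Phi> a b')) = {}"
    using Z_arcs_disjoint[OF G A_arc B_arc ne] .
  obtain N where N: "(\<Phi> a' b, N) \<in> Z_digraph G" "(\<Phi> a b', N) \<in> Z_digraph G"
    "sym_diff (\<Phi> a b') N = sym_diff (\<Phi> a b) (\<Phi> a' b)"
    using Z_arcs_commute[OF G A_arc B_arc ne] by metis
  obtain x y where xy: "x \<in> A" "y \<in> B" "N = \<Phi> x y"
    using \<Phi>_surj Z_arcD(2)[OF N(1)] by blast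
  have "leA x a'" "leB y b'"
    using \<Phi>_le[OF a(2) xy(1) b(1) xy(2)] \<Phi>_le[OF a(1) xy(1) b(2) xy(2)] N(1,2) xy(3) by blast+
  then have "(\<Phi> a' b', N) \<in> (Z_digraph G)\<^sup>*"
    using \<Phi>_le[OF a(2) xy(1) b(2) xy(2)] xy(3) by simp
  moreover have "(\<Phi> a' b, \<Phi> a' b') \<in> (Z_digraph G)\<^sup>*"
    using \<Phi>_le[OF a(2) a(2) b] leB reflA[OF a(2)] by simp
  ultimately have "\<Phi> a' b' = \<Phi> a' b \<or> \<Phi> a' b' = N"
    using Z_arc_cover[OF G N(1)] by blast
  moreover have "\<Phi> a' b' \<noteq> \<Phi> a' b"
    using \<Phi>_inj[OF a(2) a(2) b(2,1)] neB by blast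
  ultimately show "sym_diff (\<Phi> a b) (\<Phi> a' b) = sym_diff (\<Phi> a b') (\<Phi> a' b')"
    using N(3) by simp
qed

text \<open>Along a descending path from \<open>\<Phi> a b\<close> to \<open>\<Phi> a botB\<close>
  antisymmetry keeps the first coordinate at \<open>a\<close>. Every step is then a flip in the
  other factor and forms a \<open>square\<close> with the given one.\<close>

lemma arc_level_independent:
  assumes a: "a \<in> A" "a' \<in> A" and b: "b \<in> B" and arc: "(\<Phi> a b, \<Phi> a' b) \<in> Z_digraph G"
  shows "sym_diff (\<Phi> a b) (\<Phi> a' b) = sym_diff (\<Phi> a botB) (\<Phi> a' botB)"
proof -
  have "sym_diff (\<Phi> a c) (\<Phi> a' c) = sym_diff (\<Phi> a botB) (\<Phi> a' botB)"
    if "(M, \<Phi> a botB) \<in> (Z_digraph G)\<^sup>*" "M = \<Phi> a c" "c \<in> B" for M c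
    using that
  proof (induction arbitrary: c rule: converse_rtrancl_induct)
    case base
    then have "c = botB"
      using \<Phi>_inj a(1) botB(1) by metis
    then show ?case by simp
  next
    case (step M M')
    obtain x y where xy: "x \<in> A" "y \<in> B" "M' = \<Phi> x y"
      using \<Phi>_surj Z_arcD(2)[OF step(1)] by blast
    have "leA x a"
      using \<Phi>_le[OF a(1) xy(1) step.prems(2) xy(2)] step(1) xy(3) step.prems(1) by blast
    moreover have "leA a x"
      using \<Phi>_le[OF xy(1) a(1) xy(2) botB(1)] step(2) xy(3) by simp
    ultimately have x: "x = a"
      using antisymA xy(1) a(1) by blast
    have "(\<Phi> a c, \<Phi> a' c) \<in> Z_digraph G"
      using arc_change_level[OF a b step.prems(2) arc] .
    moreover have "(\<Phi> a c, \<Phi> a y) \<in> Z_digraph G"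
      using step(1) step.prems(1) xy(3) x by simp
    ultimately have "sym_diff (\<Phi> a c) (\<Phi> a' c) = sym_diff (\<Phi> a y) (\<Phi> a' y)"
      using square(1)[OF a step.prems(2) xy(2)] by blast
    then show ?case
      using step.IH[of y] xy x by simp
  qed
  moreover have "(\<Phi> a b, \<Phi> a botB) \<in> (Z_digraph G)\<^sup>*"
    using \<Phi>_le[OF a(1) a(1) b botB(1)] reflA[OF a(1)] botB(2)[OF b] by simp
  ultimately show ?thesis
    using b by blast
qed

text \<open>Looking at level \<open>botB\<close> alone is enough: by
  \<open>arc_level_independent\<close> the flips at any other level use the same cycles.\<close>

definition edgesA :: "complex set set" where
  "edgesA = moved_edges G ((\<lambda>a. \<Phi> a botB) ` A)"

lemma arc_subset_edgesA:
  assumes a: "a \<in> A" "a' \<in> A" and b: "b \<in> B" and arc: "(\<Phi> a b, \<Phi> a' b) \<in> Z_digraph G"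
  shows "sym_diff (\<Phi> a b) (\<Phi> a' b) \<subseteq> edgesA"
proof -
  have "(\<Phi> a botB, \<Phi> a' botB) \<in> Z_digraph G"
    using arc_change_level[OF a b botB(1) arc] .
  then have "sym_diff (\<Phi> a botB) (\<Phi> a' botB) \<subseteq> edgesA"
    unfolding edgesA_def moved_edges_def using a by blast
  then show ?thesis
    using arc_level_independent[OF a b arc] by simp
qed

text \<open>Antisymmetry keeps a path from \<open>\<Phi> a b\<close> down to
  \<open>\<Phi> botA b\<close> at level \<open>b\<close>, so it changes edges of
  \<open>edgesA\<close> only.\<close>

lemma change_subset_edgesA:
  assumes a: "a \<in> A" and b: "b \<in> B"
  shows "sym_diff (\<Phi> a b) (\<Phi> botA b) \<subseteq> edgesA"
proof -
  have "sym_diff M (\<Phi> botA b) \<subseteq> edgesA"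
    if "(M, \<Phi> botA b) \<in> (Z_digraph G)\<^sup>*" "M = \<Phi> c b" "c \<in> A" for M c
    using that
  proof (induction arbitrary: c rule: converse_rtrancl_induct)
    case base
    then show ?case by simp
  next
    case (step M M')
    obtain x y where xy: "x \<in> A" "y \<in> B" "M' = \<Phi> x y"
      using \<Phi>_surj Z_arcD(2)[OF step(1)] by blast
    have "leB y b"
      using \<Phi>_le[OF step.prems(2) xy(1) b xy(2)] step(1) xy(3) step.prems(1) by blast
    moreover have "leB b y"
      using \<Phi>_le[OF xy(1) botA(1) xy(2) b] step(2) xy(3) by simp
    ultimately have y: "y = b"
      using antisymB xy(2) b by blast
    have "sym_diff M M' \<subseteq> edgesA"
      using arc_subset_edgesA[OF step.prems(2) xy(1) b] step(1) step.prems(1) xy(3) y by simp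
    moreover have "sym_diff M' (\<Phi> botA b) \<subseteq> edgesA"
      using step.IH[of x] xy y by simp
    ultimately show ?case
      by blast
  qed
  moreover have "(\<Phi> a b, \<Phi> botA b) \<in> (Z_digraph G)\<^sup>*"
    using \<Phi>_le[OF a botA(1) b b] reflB[OF b] botA(2)[OF a] by simp
  ultimately show ?thesis
    using a by blast
qed

lemma edgesA_subset: "edgesA \<subseteq> edges G"
  unfolding edgesA_def moved_edges_def
  using perfect_matching_subset Z_arcD(1,2) by fast

lemma edges_disjoint:
  assumes c: "c \<in> edgesA" and d: "d \<in> moved_edges G (\<Phi> botA ` B)"
  shows "c \<inter> d = {}"
proof -
  interpret sw: matching_product G B leB botB A leA botA "\<lambda>b a. \<Phi> a b"
    by (rule swap)
  obtain a a' where a: "a \<in> A" "a' \<in> A" and A_arc: "(\<Phi> a botB, \<Phi> a' botB) \<in> Z_digraph G"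
    and ca: "c \<in> sym_diff (\<Phi> a botB) (\<Phi> a' botB)"
    using c unfolding edgesA_def moved_edges_def by blast
  obtain b b' where b: "b \<in> B" "b' \<in> B" and B_arc: "(\<Phi> botA b, \<Phi> botA b') \<in> Z_digraph G"
    and db: "d \<in> sym_diff (\<Phi> botA b) (\<Phi> botA b')"
    using d unfolding moved_edges_def by blast
  \<comment> \<open>The two flips are known at different base levels. Moved to the common starting
    matching \<open>\<Phi> a b\<close> they keep their cycles, and there the boundaries are
    disjoint.\<close>
  have A_arc': "(\<Phi> a b, \<Phi> a' b) \<in> Z_digraph G"
    using arc_change_level[OF a botB(1) b(1) A_arc] .
  have B_arc': "(\<Phi> a b, \<Phi> a b') \<in> Z_digraph G"
    using sw.arc_change_level[OF b botA(1) a(1) B_arc] .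
  have "c \<in> sym_diff (\<Phi> a b) (\<Phi> a' b)" "d \<in> sym_diff (\<Phi> a b) (\<Phi> a b')"
    using arc_level_independent[OF a b(1) A_arc'] sw.arc_level_independent[OF b a(1) B_arc'] ca db
    by simp_all
  then show ?thesis
    using square(2)[OF a b A_arc' B_arc'] by blast
qed

text \<open>Write \<open>M\<close> as \<open>\<Phi> a b\<close>. Its difference from
  \<open>\<Phi> a botB\<close> consists of edges moving \<open>A\<close>, by assumption, and of
  edges moving \<open>B\<close>, as only the second coordinate changes. Such edges are disjoint as
  point sets and not empty, so nothing remains.\<close>

lemma matching_off_edgesA:
  assumes M: "M \<in> perfect_matchings G" and eq: "M - edgesA = \<Phi> botA botB - edgesA"
  shows "\<exists>a\<in>A. M = \<Phi> a botB"
proof -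
  interpret sw: matching_product G B leB botB A leA botA "\<lambda>b a. \<Phi> a b"
    by (rule swap)
  obtain a b where ab: "a \<in> A" "b \<in> B" "M = \<Phi> a b"
    using \<Phi>_surj[OF M] by blast
  have "sym_diff (\<Phi> a b) (\<Phi> a botB) \<subseteq> edgesA"
    using eq change_subset_edgesA[OF ab(1) botB(1)] unfolding ab(3) by blast
  moreover have "sym_diff (\<Phi> a b) (\<Phi> a botB) \<subseteq> moved_edges G (\<Phi> botA ` B)"
    using sw.change_subset_edgesA[OF ab(2,1)] unfolding sw.edgesA_def .
  moreover have "e \<noteq> {}" if "e \<in> edgesA" for e
    using edge_path(2)[OF G subsetD[OF edgesA_subset that]] path_image_nonempty by metis
  ultimately have "sym_diff (\<Phi> a b) (\<Phi> a botB) = {}"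
    using edges_disjoint by blast
  then show ?thesis
    using ab by blast
qed

lemma matching_eq_off_edgesA:
  "a \<in> A \<Longrightarrow> \<Phi> a botB - edgesA = \<Phi> botA botB - edgesA"
  using change_subset_edgesA[OF _ botB(1), of a] by blast

text \<open>Some matching at level \<open>botB\<close> covers \<open>v\<close> by an edge of
  \<open>edgesA\<close>. All matchings at this level agree off \<open>edgesA\<close>, so an edge at
  \<open>v\<close> outside \<open>edgesA\<close> would be a second edge at \<open>v\<close> in that
  matching. This is why restricting to \<open>edgesA\<close> preserves perfect matchings.\<close>

lemma covered_by_edgesA:
  assumes a: "a \<in> A" and v: "v \<in> verts G" "v \<in> \<Union> edgesA" and e: "e \<in> \<Phi> a botB" "v \<in> e"
  shows "e \<in> edgesA"
proof -
  obtain x x' where x: "x \<in> A" "x' \<in> A" and arc: "(\<Phi> x botB, \<Phi> x' botB) \<in> Z_digraph G"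
    and vx: "v \<in> \<Union> (sym_diff (\<Phi> x botB) (\<Phi> x' botB))"
    using v(2) unfolding edgesA_def moved_edges_def by blast
  obtain d where d: "d \<in> \<Phi> x botB" "d \<notin> \<Phi> x' botB" "v \<in> d"
    using moved_vertex_edge[OF Z_arcD(1,2)[OF arc] v(1) vx] .
  have "d \<in> edgesA"
    using arc_subset_edgesA[OF x botB(1) arc] d by blast
  moreover have "e = d" if "e \<notin> edgesA"
  proof -
    have "e \<in> \<Phi> x botB"
      using that e(1) matching_eq_off_edgesA[OF a] matching_eq_off_edgesA[OF x(1)] by blast
    then show ?thesis
      using perfect_matching_unique[OF \<Phi>_matching[OF x(1) botB(1)] v(1) _ d(1) e(2) d(3)] by simp
  qed
  ultimately show ?thesis
    by blast
qed

end

section \<open>The subgraph that realises one factor\<close>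

text \<open>Vertices on no chosen edge are dropped, since an isolated vertex would rule out perfect
  matchings.\<close>

definition edge_subgraph :: "plane_bigraph \<Rightarrow> complex set set \<Rightarrow> plane_bigraph" where
  "edge_subgraph G E = \<lparr>white = white G \<inter> \<Union> E, black = black G \<inter> \<Union> E, edges = E\<rparr>"

lemma edge_subgraph_sel [simp]:
  "white (edge_subgraph G E) = white G \<inter> \<Union> E" "black (edge_subgraph G E) = black G \<inter> \<Union> E"
  "edges (edge_subgraph G E) = E" "verts (edge_subgraph G E) = verts G \<inter> \<Union> E"
  by (auto simp: edge_subgraph_def verts_def)

lemma plane_edge_subgraph:
  assumes G: "plane_bipartite_graph G" and E: "E \<subseteq> edges G"
  shows "plane_bipartite_graph (edge_subgraph G E)"
proof -
  have v: "e \<inter> (verts G \<inter> \<Union> E) = e \<inter> verts G" if "e \<in> E" for e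
    using that by blast
  note G' = G[unfolded plane_bipartite_graph_def]
  show ?thesis
    unfolding plane_bipartite_graph_def edge_subgraph_sel
  proof (intro conjI ballI impI)
    show "finite (verts G \<inter> \<Union> E)" "finite E" "white G \<inter> \<Union> E \<inter> (black G \<inter> \<Union> E) = {}"
      using G' E finite_subset by auto
  next
    fix e assume e: "e \<in> E"
    then have eG: "e \<in> edges G"
      using E by blast
    show "\<exists>g. arc g \<and> path_image g = e \<and> {pathstart g, pathfinish g} = e \<inter> (verts G \<inter> \<Union> E)"
      using edge_path[OF G eG] v[OF e] by metis
    have "e \<inter> white G \<noteq> {}" "e \<inter> black G \<noteq> {}"
      using G' eG by simp_all
    then show "e \<inter> (white G \<inter> \<Union> E) \<noteq> {}" "e \<inter> (black G \<inter> \<Union> E) \<noteq> {}"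
      using e by blast+
    fix e' assume e': "e' \<in> E" "e \<noteq> e'"
    then have "e \<inter> verts G \<noteq> e' \<inter> verts G" and sub: "e \<inter> e' \<subseteq> verts G"
      using G' eG E by blast+
    then show "e \<inter> (verts G \<inter> \<Union> E) \<noteq> e' \<inter> (verts G \<inter> \<Union> E)"
      using v[OF e] v[OF e'(1)] by simp
    show "e \<inter> e' \<subseteq> verts G \<inter> \<Union> E"
      using sub e by blast
  qed
qed

lemma proper_cycle_edge_subgraph:
  assumes E: "E \<subseteq> edges G"
  shows "proper_alternating_cycle (edge_subgraph G E) M C \<longleftrightarrow> C \<subseteq> E \<and> proper_alternating_cycle G M C"
proof -
  have cyc: "is_cycle (edge_subgraph G E) vs es \<longleftrightarrow> set es \<subseteq> E \<and> is_cycle G vs es" for vs es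
  proof (cases "set es \<subseteq> E \<and> length es = length vs")
    case True
    then have "es ! i \<inter> (verts G \<inter> \<Union> E) = es ! i \<inter> verts G" if "i < length vs" for i
    proof -
      have "es ! i \<in> E"
        using that True by (metis nth_mem subsetD)
      then show ?thesis
        by blast
    qed
    then show ?thesis
      using True E unfolding is_cycle_def edge_subgraph_sel by auto
  next
    case False
    then show ?thesis
      unfolding is_cycle_def edge_subgraph_sel by auto
  qed
  have mem: "vs ! i \<in> \<Union> E \<and> vs ! (Suc i mod length vs) \<in> \<Union> E"
    if "set es \<subseteq> E" "is_cycle G vs es" "i < length vs" for vs es i
  proof -
    have "es ! i \<in> E"
      using that nth_mem[of i es] unfolding is_cycle_def by auto
    moreover have "es ! i \<inter> verts G = {vs ! i, vs ! (Suc i mod length vs)}"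
      using that unfolding is_cycle_def by simp
    ultimately show ?thesis
      by blast
  qed
  have col: "(\<forall>i<length vs. es ! i \<in> M \<longrightarrow>
          vs ! i \<in> white G \<inter> \<Union> E \<and> vs ! (Suc i mod length vs) \<in> black G \<inter> \<Union> E) \<longleftrightarrow>
      (\<forall>i<length vs. es ! i \<in> M \<longrightarrow>
          vs ! i \<in> white G \<and> vs ! (Suc i mod length vs) \<in> black G)"
    if "set es \<subseteq> E" "is_cycle G vs es" for vs es
    using mem[OF that] by (auto simp del: Union_iff)
  show ?thesis
  proof
    assume "proper_alternating_cycle (edge_subgraph G E) M C"
    then obtain vs es where "set es \<subseteq> E" "is_cycle G vs es" and es: "clockwise vs es" "set es = C"
      "alternating M es" and wb: "\<forall>i<length vs. es ! i \<in> M \<longrightarrow>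
          vs ! i \<in> white G \<inter> \<Union> E \<and> vs ! (Suc i mod length vs) \<in> black G \<inter> \<Union> E"
      unfolding proper_alternating_cycle_def cyc edge_subgraph_sel by blast
    then show "C \<subseteq> E \<and> proper_alternating_cycle G M C"
      unfolding proper_alternating_cycle_def using col[THEN iffD1, OF _ _ wb] by blast
  next
    assume "C \<subseteq> E \<and> proper_alternating_cycle G M C"
    then obtain vs es where "set es \<subseteq> E" "is_cycle G vs es" and es: "clockwise vs es" "set es = C"
      "alternating M es" and wb: "\<forall>i<length vs. es ! i \<in> M \<longrightarrow>
          vs ! i \<in> white G \<and> vs ! (Suc i mod length vs) \<in> black G"
      unfolding proper_alternating_cycle_def by blast
    then show "proper_alternating_cycle (edge_subgraph G E) M C"
      unfolding proper_alternating_cycle_def cyc edge_subgraph_sel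
      using col[THEN iffD2, OF _ _ wb] by blast
  qed
qed

locale matching_product_join = matching_product +
  assumes join: "a \<in> A \<Longrightarrow> a' \<in> A \<Longrightarrow>
    \<exists>j\<in>A. leA a j \<and> leA a' j \<and> (\<forall>x\<in>A. leA a x \<longrightarrow> leA a' x \<longrightarrow> leA j x)"
begin

definition H :: plane_bigraph where
  "H = edge_subgraph G edgesA"

definition \<psi> :: "'a \<Rightarrow> complex set set" where
  "\<psi> a = \<Phi> a botB \<inter> edgesA"

lemma plane_H: "plane_bipartite_graph H"
  unfolding H_def using G edgesA_subset by (rule plane_edge_subgraph)

lemma H_sel [simp]: "edges H = edgesA" "verts H = verts G \<inter> \<Union> edgesA"
  by (simp_all add: H_def)

lemma sym_diff_\<psi>:
  "a \<in> A \<Longrightarrow> a' \<in> A \<Longrightarrow> sym_diff (\<psi> a) (\<psi> a') = sym_diff (\<Phi> a botB) (\<Phi> a' botB)"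
  using matching_eq_off_edgesA[of a] matching_eq_off_edgesA[of a'] unfolding \<psi>_def by blast

lemma \<psi>_inj: "a \<in> A \<Longrightarrow> a' \<in> A \<Longrightarrow> \<psi> a = \<psi> a' \<Longrightarrow> a = a'"
  using sym_diff_\<psi>[of a a'] \<Phi>_inj[of a a' botB botB] botB(1) by auto

lemma \<psi>_matching:
  assumes a: "a \<in> A"
  shows "\<psi> a \<in> perfect_matchings H"
proof -
  have "\<exists>!e. e \<in> \<psi> a \<and> v \<in> e" if v: "v \<in> verts G" "v \<in> \<Union> edgesA" for v
  proof -
    have "e \<in> \<psi> a \<and> v \<in> e \<longleftrightarrow> e \<in> \<Phi> a botB \<and> v \<in> e" for e
      using covered_by_edgesA[OF a v] unfolding \<psi>_def by blast
    then show ?thesis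
      using \<Phi>_matching[OF a botB(1)] v(1) by (simp add: perfect_matchings_def)
  qed
  moreover have "\<psi> a \<subseteq> edgesA"
    by (simp add: \<psi>_def)
  ultimately show ?thesis
    by (simp add: perfect_matchings_def)
qed

lemma \<psi>_surj:
  assumes N: "N \<in> perfect_matchings H"
  shows "\<exists>a\<in>A. N = \<psi> a"
proof -
  \<comment> \<open>The matchings at level \<open>botB\<close> share one fixed part off
    \<open>edgesA\<close>; adding it to \<open>N\<close> gives a perfect matching of
    \<open>G\<close>.\<close>
  define M where "M = N \<union> (\<Phi> botA botB - edgesA)"
  have NE: "N \<subseteq> edgesA"
    using perfect_matching_subset[OF N] by simp
  note M0 = \<Phi>_matching[OF botA(1) botB(1)]
  have "M \<in> perfect_matchings G"
  proof -
    have "\<exists>!e. e \<in> M \<and> v \<in> e" if v: "v \<in> verts G" for v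
    proof (cases "v \<in> \<Union> edgesA")
      case True
      then have "e \<in> M \<and> v \<in> e \<longleftrightarrow> e \<in> N \<and> v \<in> e" for e
        using covered_by_edgesA[OF botA(1) v] unfolding M_def by blast
      then show ?thesis
        using N v True by (simp add: perfect_matchings_def)
    next
      case False
      then have "e \<in> M \<and> v \<in> e \<longleftrightarrow> e \<in> \<Phi> botA botB \<and> v \<in> e" for e
        using NE unfolding M_def by blast
      then show ?thesis
        using M0 v by (simp add: perfect_matchings_def)
    qed
    moreover have "M \<subseteq> edges G"
      using NE edgesA_subset perfect_matching_subset[OF M0] unfolding M_def by blast
    ultimately show ?thesis
      by (simp add: perfect_matchings_def)
  qed
  moreover have "M - edgesA = \<Phi> botA botB - edgesA"
    using NE unfolding M_def by blast
  ultimately obtain a where a: "a \<in> A" "M = \<Phi> a botB"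
    using matching_off_edgesA by blast
  have "N = \<psi> a"
    unfolding \<psi>_def a(2)[symmetric] M_def using NE by blast
  then show ?thesis
    using a(1) by blast
qed

lemma proper_cycle_\<psi>:
  assumes a: "a \<in> A" "a' \<in> A"
  shows "proper_alternating_cycle H (\<psi> a) (sym_diff (\<psi> a) (\<psi> a')) \<longleftrightarrow>
    proper_alternating_cycle G (\<Phi> a botB) (sym_diff (\<Phi> a botB) (\<Phi> a' botB))"
proof -
  have "sym_diff (\<psi> a) (\<psi> a') \<subseteq> edgesA"
    unfolding \<psi>_def by blast
  then have sub: "sym_diff (\<Phi> a botB) (\<Phi> a' botB) \<subseteq> edgesA"
    using sym_diff_\<psi>[OF a] by simp
  then have "\<psi> a \<inter> sym_diff (\<Phi> a botB) (\<Phi> a' botB) = \<Phi> a botB \<inter> sym_diff (\<Phi> a botB) (\<Phi> a' botB)"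
    unfolding \<psi>_def by blast
  from proper_cycle_cong[OF this] show ?thesis
    unfolding sym_diff_\<psi>[OF a] H_def proper_cycle_edge_subgraph[OF edgesA_subset] using sub by blast
qed

text \<open>Deleting edges shrinks the drawing, so a cycle interior that avoided it still
  does.\<close>

lemma \<psi>_arc:
  assumes a: "a \<in> A" "a' \<in> A" and arc: "(\<Phi> a botB, \<Phi> a' botB) \<in> Z_digraph G"
  shows "(\<psi> a, \<psi> a') \<in> Z_digraph H"
proof -
  have "support H \<subseteq> support G"
    using edgesA_subset by (auto simp: support_def)
  then have "inside (\<Union> (sym_diff (\<psi> a) (\<psi> a'))) \<inter> support H = {}"
    using Z_arcD(4)[OF arc] unfolding sym_diff_\<psi>[OF a] by blast
  moreover have "proper_alternating_cycle H (\<psi> a) (sym_diff (\<psi> a) (\<psi> a'))"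
    using Z_arcD(3)[OF arc] proper_cycle_\<psi>[OF a] by blast
  ultimately show ?thesis
    using \<psi>_matching[OF a(1)] \<psi>_matching[OF a(2)] unfolding Z_digraph_iff by blast
qed

lemma \<psi>_arcD:
  assumes a: "a \<in> A" "a' \<in> A" and arc: "(\<psi> a, \<psi> a') \<in> Z_digraph H"
  shows "leA a' a"
proof -
  obtain j where j: "j \<in> A" "leA a j" "leA a' j" "\<forall>x\<in>A. leA a x \<longrightarrow> leA a' x \<longrightarrow> leA j x"
    using join[OF a] by blast
  have "(\<Phi> a botB, \<Phi> a' botB) \<in> (Z_digraph G)\<^sup>*"
  proof (rule proper_cycle_switch_le[OF G])
    show "\<Phi> a botB \<in> perfect_matchings G" "\<Phi> a' botB \<in> perfect_matchings G"
      using \<Phi>_matching a botB(1) by auto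
    show "proper_alternating_cycle G (\<Phi> a botB) (sym_diff (\<Phi> a botB) (\<Phi> a' botB))"
      using Z_arcD(3)[OF arc] proper_cycle_\<psi>[OF a] by blast
    show "(\<Phi> j botB, \<Phi> a botB) \<in> (Z_digraph G)\<^sup>*" "(\<Phi> j botB, \<Phi> a' botB) \<in> (Z_digraph G)\<^sup>*"
      using \<Phi>_le a j botB reflB by auto
  next
    fix K assume K: "(K, \<Phi> a botB) \<in> (Z_digraph G)\<^sup>*" "(K, \<Phi> a' botB) \<in> (Z_digraph G)\<^sup>*"
    then have "K \<in> perfect_matchings G"
      using Z_rtrancl_matching \<Phi>_matching[OF a(1) botB(1)] by blast
    then obtain x y where xy: "x \<in> A" "y \<in> B" "K = \<Phi> x y"
      using \<Phi>_surj by blast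
    then have "leA a x" "leA a' x"
      using \<Phi>_le a botB(1) K by blast+
    \<comment> \<open>An upper bound may lie at any level \<open>y\<close>; as \<open>botB\<close>
      is below \<open>y\<close>, the join in \<open>A\<close> taken at level \<open>botB\<close> is
      a join in the whole matching poset.\<close>
    then show "(K, \<Phi> j botB) \<in> (Z_digraph G)\<^sup>*"
      using \<Phi>_le j botB xy by simp
  qed
  then show ?thesis
    using \<Phi>_le a botB(1) by blast
qed

lemma \<psi>_le:
  assumes a: "a \<in> A" "a' \<in> A"
  shows "leA a' a \<longleftrightarrow> (\<psi> a, \<psi> a') \<in> (Z_digraph H)\<^sup>*"
proof
  assume "leA a' a"
  have "(\<psi> c, \<psi> a') \<in> (Z_digraph H)\<^sup>*"
    if "(M, \<Phi> a' botB) \<in> (Z_digraph G)\<^sup>*" "M = \<Phi> c botB" "c \<in> A" for M c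
    using that
  proof (induction arbitrary: c rule: converse_rtrancl_induct)
    case base
    then have "c = a'"
      using \<Phi>_inj a(2) botB(1) by metis
    then show ?case by simp
  next
    case (step M M')
    obtain x y where xy: "x \<in> A" "y \<in> B" "M' = \<Phi> x y"
      using \<Phi>_surj Z_arcD(2)[OF step(1)] by blast
    have "leB y botB"
      using \<Phi>_le[OF step.prems(2) xy(1) botB(1) xy(2)] step(1) xy(3) step.prems(1) by blast
    then have y: "y = botB"
      using antisymB xy(2) botB by blast
    have "(\<psi> c, \<psi> x) \<in> Z_digraph H"
      using \<psi>_arc[OF step.prems(2) xy(1)] step(1) step.prems(1) xy(3) y by simp
    moreover have "(\<psi> x, \<psi> a') \<in> (Z_digraph H)\<^sup>*"
      using step.IH[of x] xy y by simp
    ultimately show ?case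
      by simp
  qed
  then show "(\<psi> a, \<psi> a') \<in> (Z_digraph H)\<^sup>*"
    using \<Phi>_le[OF a botB(1) botB(1)] \<open>leA a' a\<close> reflB[OF botB(1)] a(1) by blast
next
  assume "(\<psi> a, \<psi> a') \<in> (Z_digraph H)\<^sup>*"
  moreover have "(\<Phi> a botB, \<Phi> c botB) \<in> (Z_digraph G)\<^sup>*"
    if "(\<psi> a, N) \<in> (Z_digraph H)\<^sup>*" "N = \<psi> c" "c \<in> A" for N c
    using that
  proof (induction arbitrary: c rule: rtrancl_induct)
    case base
    then have "c = a"
      using \<psi>_inj a(1) by metis
    then show ?case by simp
  next
    case (step N N')
    obtain x where x: "x \<in> A" "N = \<psi> x"
      using \<psi>_surj Z_arcD(1)[OF step(2)] by blast
    have "leA c x"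
      using \<psi>_arcD[OF x(1) step.prems(2)] step(2) step.prems(1) x(2) by simp
    then have "(\<Phi> x botB, \<Phi> c botB) \<in> (Z_digraph G)\<^sup>*"
      using \<Phi>_le[OF x(1) step.prems(2) botB(1) botB(1)] reflB[OF botB(1)] by simp
    then show ?case
      using step.IH[OF x(2,1)] by simp
  qed
  ultimately show "leA a' a"
    using \<Phi>_le[OF a botB(1) botB(1)] a(2) by blast
qed

end

subsection \<open>Disjoint unions\<close>


definition disjoint_union :: "plane_bigraph \<Rightarrow> plane_bigraph \<Rightarrow> plane_bigraph" where
  "disjoint_union G\<^sub>1 G\<^sub>2 =
     \<lparr>white = white G\<^sub>1 \<union> white G\<^sub>2, black = black G\<^sub>1 \<union> black G\<^sub>2, edges = edges G\<^sub>1 \<union> edges G\<^sub>2\<rparr>"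

lemma disjoint_union_sel [simp]:
  "white (disjoint_union G\<^sub>1 G\<^sub>2) = white G\<^sub>1 \<union> white G\<^sub>2"
  "black (disjoint_union G\<^sub>1 G\<^sub>2) = black G\<^sub>1 \<union> black G\<^sub>2"
  "edges (disjoint_union G\<^sub>1 G\<^sub>2) = edges G\<^sub>1 \<union> edges G\<^sub>2"
  "verts (disjoint_union G\<^sub>1 G\<^sub>2) = verts G\<^sub>1 \<union> verts G\<^sub>2"
  "support (disjoint_union G\<^sub>1 G\<^sub>2) = support G\<^sub>1 \<union> support G\<^sub>2"
  by (auto simp: disjoint_union_def verts_def support_def)

lemma disjoint_union_commute: "disjoint_union G\<^sub>1 G\<^sub>2 = disjoint_union G\<^sub>2 G\<^sub>1"
  by (simp add: disjoint_union_def Un_commute)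

text \<open>Convexity keeps the interior of a cycle within the region of its graph, and openness
  separates connected cycles. The existence of matchings ensures that no vertex is isolated.\<close>

locale separated_graphs =
  fixes G\<^sub>1 G\<^sub>2 :: plane_bigraph and S\<^sub>1 S\<^sub>2 :: "complex set"
  assumes G\<^sub>1: "plane_bipartite_graph G\<^sub>1" and G\<^sub>2: "plane_bipartite_graph G\<^sub>2"
    and matching\<^sub>1: "perfect_matchings G\<^sub>1 \<noteq> {}" and matching\<^sub>2: "perfect_matchings G\<^sub>2 \<noteq> {}"
    and S\<^sub>1: "open S\<^sub>1" "convex S\<^sub>1" "support G\<^sub>1 \<subseteq> S\<^sub>1"
    and S\<^sub>2: "open S\<^sub>2" "convex S\<^sub>2" "support G\<^sub>2 \<subseteq> S\<^sub>2"
    and S_disjoint: "S\<^sub>1 \<inter> S\<^sub>2 = {}"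
begin

abbreviation "U \<equiv> disjoint_union G\<^sub>1 G\<^sub>2"

lemma swap: "separated_graphs G\<^sub>2 G\<^sub>1 S\<^sub>2 S\<^sub>1"
  using G\<^sub>1 G\<^sub>2 matching\<^sub>1 matching\<^sub>2 S\<^sub>1 S\<^sub>2 S_disjoint by unfold_locales auto

lemma in_S\<^sub>1: "v \<in> verts G\<^sub>1 \<Longrightarrow> v \<in> S\<^sub>1" "e \<in> edges G\<^sub>1 \<Longrightarrow> e \<subseteq> S\<^sub>1"
  and in_S\<^sub>2: "v \<in> verts G\<^sub>2 \<Longrightarrow> v \<in> S\<^sub>2" "e \<in> edges G\<^sub>2 \<Longrightarrow> e \<subseteq> S\<^sub>2"
  using S\<^sub>1(3) S\<^sub>2(3) unfolding support_def by blast+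

lemma edge_nonempty: "e \<in> edges G\<^sub>1 \<union> edges G\<^sub>2 \<Longrightarrow> e \<noteq> {}"
  using edge_path(2)[OF G\<^sub>1] edge_path(2)[OF G\<^sub>2] path_image_nonempty by (metis UnE)

lemma edges_disjoint: "edges G\<^sub>1 \<inter> edges G\<^sub>2 = {}"
proof -
  have "e = {}" if "e \<in> edges G\<^sub>1" "e \<in> edges G\<^sub>2" for e
    using in_S\<^sub>1(2)[OF that(1)] in_S\<^sub>2(2)[OF that(2)] S_disjoint by blast
  then show ?thesis
    using edge_nonempty by blast
qed

lemma edge_verts:
  "e \<in> edges G\<^sub>1 \<Longrightarrow> e \<inter> (verts G\<^sub>1 \<union> verts G\<^sub>2) = e \<inter> verts G\<^sub>1"
  "e \<in> edges G\<^sub>2 \<Longrightarrow> e \<inter> (verts G\<^sub>1 \<union> verts G\<^sub>2) = e \<inter> verts G\<^sub>2"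
  using in_S\<^sub>1 in_S\<^sub>2 S_disjoint by blast+

lemma plane_U: "plane_bipartite_graph U"
proof -
  note P1 = G\<^sub>1[unfolded plane_bipartite_graph_def] and P2 = G\<^sub>2[unfolded plane_bipartite_graph_def]
  have e12: "e \<inter> verts G\<^sub>1 \<noteq> e' \<inter> verts G\<^sub>2 \<and> e \<inter> e' = {}" if "e \<in> edges G\<^sub>1" "e' \<in> edges G\<^sub>2" for e e'
  proof -
    have "e \<inter> verts G\<^sub>1 \<noteq> {}"
      using edge_path(5)[OF G\<^sub>1 that(1)] by blast
    then show ?thesis
      using in_S\<^sub>1(2)[OF that(1)] in_S\<^sub>2(2)[OF that(2)] S_disjoint by blast
  qed
  have wb: "white G\<^sub>1 \<inter> black G\<^sub>1 = {}" "white G\<^sub>2 \<inter> black G\<^sub>2 = {}"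
    using P1 P2 by simp_all
  have w1: "e \<inter> white G\<^sub>1 \<noteq> {} \<and> e \<inter> black G\<^sub>1 \<noteq> {}" if "e \<in> edges G\<^sub>1" for e
    using P1 that by simp
  have w2: "e \<inter> white G\<^sub>2 \<noteq> {} \<and> e \<inter> black G\<^sub>2 \<noteq> {}" if "e \<in> edges G\<^sub>2" for e
    using P2 that by simp
  show ?thesis
    unfolding plane_bipartite_graph_def disjoint_union_sel
  proof (intro conjI ballI impI)
    show "finite (verts G\<^sub>1 \<union> verts G\<^sub>2)" "finite (edges G\<^sub>1 \<union> edges G\<^sub>2)"
      using P1 P2 by auto
    have "white G\<^sub>1 \<inter> black G\<^sub>2 = {}" "white G\<^sub>2 \<inter> black G\<^sub>1 = {}"
      using in_S\<^sub>1(1) in_S\<^sub>2(1) S_disjoint unfolding verts_def by blast+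
    then show "(white G\<^sub>1 \<union> white G\<^sub>2) \<inter> (black G\<^sub>1 \<union> black G\<^sub>2) = {}"
      using wb by blast
  next
    fix e assume e: "e \<in> edges G\<^sub>1 \<union> edges G\<^sub>2"
    show "\<exists>g. arc g \<and> path_image g = e \<and> {pathstart g, pathfinish g} = e \<inter> (verts G\<^sub>1 \<union> verts G\<^sub>2)"
      using e edge_path[OF G\<^sub>1] edge_path[OF G\<^sub>2] edge_verts by (metis UnE)
    have "e \<inter> white G\<^sub>1 \<noteq> {} \<and> e \<inter> black G\<^sub>1 \<noteq> {} \<or> e \<inter> white G\<^sub>2 \<noteq> {} \<and> e \<inter> black G\<^sub>2 \<noteq> {}"
      using e w1 w2 by blast
    then show "e \<inter> (white G\<^sub>1 \<union> white G\<^sub>2) \<noteq> {}" "e \<inter> (black G\<^sub>1 \<union> black G\<^sub>2) \<noteq> {}"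
      by blast+
    fix e' assume e': "e' \<in> edges G\<^sub>1 \<union> edges G\<^sub>2" "e \<noteq> e'"
    consider "e \<in> edges G\<^sub>1" "e' \<in> edges G\<^sub>1" | "e \<in> edges G\<^sub>1" "e' \<in> edges G\<^sub>2"
      | "e \<in> edges G\<^sub>2" "e' \<in> edges G\<^sub>1" | "e \<in> edges G\<^sub>2" "e' \<in> edges G\<^sub>2"
      using e e' by blast
    then have "e \<inter> (verts G\<^sub>1 \<union> verts G\<^sub>2) \<noteq> e' \<inter> (verts G\<^sub>1 \<union> verts G\<^sub>2) \<and>
        e \<inter> e' \<subseteq> verts G\<^sub>1 \<union> verts G\<^sub>2"
    proof cases
      case 1
      then have "e \<inter> verts G\<^sub>1 \<noteq> e' \<inter> verts G\<^sub>1" "e \<inter> e' \<subseteq> verts G\<^sub>1"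
        using P1 e'(2) by simp_all
      then show ?thesis
        using edge_verts(1)[OF 1(1)] edge_verts(1)[OF 1(2)] by auto
    next
      case 2
      then show ?thesis
        using e12[OF 2] edge_verts(1)[OF 2(1)] edge_verts(2)[OF 2(2)] by auto
    next
      case 3
      then show ?thesis
        using e12[OF 3(2,1)] edge_verts(2)[OF 3(1)] edge_verts(1)[OF 3(2)] by auto
    next
      case 4
      then have "e \<inter> verts G\<^sub>2 \<noteq> e' \<inter> verts G\<^sub>2" "e \<inter> e' \<subseteq> verts G\<^sub>2"
        using P2 e'(2) by simp_all
      then show ?thesis
        using edge_verts(2)[OF 4(1)] edge_verts(2)[OF 4(2)] by auto
    qed
    then show "e \<inter> (verts G\<^sub>1 \<union> verts G\<^sub>2) \<noteq> e' \<inter> (verts G\<^sub>1 \<union> verts G\<^sub>2)"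
      "e \<inter> e' \<subseteq> verts G\<^sub>1 \<union> verts G\<^sub>2"
      by blast+
  qed
qed

text \<open>A perfect matching covers every vertex of \<open>G\<^sub>1\<close> by an edge, so
  selecting edges loses no vertex. Facts on cycles in edge subgraphs thereby apply to the
  union.\<close>

lemma edge_subgraph_U: "edge_subgraph U (edges G\<^sub>1) = G\<^sub>1"
proof -
  obtain M where M: "M \<in> perfect_matchings G\<^sub>1"
    using matching\<^sub>1 by blast
  have cov: "verts G\<^sub>1 \<subseteq> \<Union> (edges G\<^sub>1)"
    using perfect_matching_edge[OF M] perfect_matching_subset[OF M] by blast
  moreover have "verts G\<^sub>2 \<inter> \<Union> (edges G\<^sub>1) = {}"
    using in_S\<^sub>1(2) in_S\<^sub>2(1) S_disjoint by blast
  ultimately have "(white G\<^sub>1 \<union> white G\<^sub>2) \<inter> \<Union> (edges G\<^sub>1) = white G\<^sub>1"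
    "(black G\<^sub>1 \<union> black G\<^sub>2) \<inter> \<Union> (edges G\<^sub>1) = black G\<^sub>1"
    unfolding verts_def by blast+
  then show ?thesis
    by (simp add: edge_subgraph_def)
qed

lemma proper_cycle_U:
  "proper_alternating_cycle G\<^sub>1 M C \<longleftrightarrow> C \<subseteq> edges G\<^sub>1 \<and> proper_alternating_cycle U M C"
  using proper_cycle_edge_subgraph[of "edges G\<^sub>1" U M C] edge_subgraph_U by simp

lemma matching_U:
  "M \<in> perfect_matchings U \<longleftrightarrow> M \<subseteq> edges G\<^sub>1 \<union> edges G\<^sub>2 \<and>
     M \<inter> edges G\<^sub>1 \<in> perfect_matchings G\<^sub>1 \<and> M \<inter> edges G\<^sub>2 \<in> perfect_matchings G\<^sub>2"
proof (cases "M \<subseteq> edges G\<^sub>1 \<union> edges G\<^sub>2")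
  case True
  have 1: "e \<in> M \<and> v \<in> e \<longleftrightarrow> e \<in> M \<inter> edges G\<^sub>1 \<and> v \<in> e" if "v \<in> verts G\<^sub>1" for e v
    using True in_S\<^sub>1(1)[OF that] in_S\<^sub>2(2) S_disjoint by blast
  have 2: "e \<in> M \<and> v \<in> e \<longleftrightarrow> e \<in> M \<inter> edges G\<^sub>2 \<and> v \<in> e" if "v \<in> verts G\<^sub>2" for e v
    using True in_S\<^sub>2(1)[OF that] in_S\<^sub>1(2) S_disjoint by blast
  have "(\<forall>v\<in>verts G\<^sub>1 \<union> verts G\<^sub>2. \<exists>!e. e \<in> M \<and> v \<in> e) \<longleftrightarrow>
    (\<forall>v\<in>verts G\<^sub>1. \<exists>!e. e \<in> M \<inter> edges G\<^sub>1 \<and> v \<in> e) \<and> (\<forall>v\<in>verts G\<^sub>2. \<exists>!e. e \<in> M \<inter> edges G\<^sub>2 \<and> v \<in> e)"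
    by (simp only: ball_Un 1 2 cong: ball_cong)
  then show ?thesis
    using True unfolding perfect_matchings_def by simp
next
  case False
  then show ?thesis
    using perfect_matching_subset[of M U] by auto
qed

lemma matching_U_Un:
  assumes "M\<^sub>1 \<in> perfect_matchings G\<^sub>1" "M\<^sub>2 \<in> perfect_matchings G\<^sub>2"
  shows "M\<^sub>1 \<union> M\<^sub>2 \<in> perfect_matchings U"
    "(M\<^sub>1 \<union> M\<^sub>2) \<inter> edges G\<^sub>1 = M\<^sub>1" "(M\<^sub>1 \<union> M\<^sub>2) \<inter> edges G\<^sub>2 = M\<^sub>2"
proof -
  have s: "M\<^sub>1 \<subseteq> edges G\<^sub>1" "M\<^sub>2 \<subseteq> edges G\<^sub>2"
    using assms perfect_matching_subset by auto
  show i: "(M\<^sub>1 \<union> M\<^sub>2) \<inter> edges G\<^sub>1 = M\<^sub>1" "(M\<^sub>1 \<union> M\<^sub>2) \<inter> edges G\<^sub>2 = M\<^sub>2"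
    using s edges_disjoint by blast+
  show "M\<^sub>1 \<union> M\<^sub>2 \<in> perfect_matchings U"
    unfolding matching_U i using assms s by blast
qed

lemma arc_U:
  assumes arc: "(M, N) \<in> Z_digraph G\<^sub>1" and K: "K \<in> perfect_matchings G\<^sub>2"
  shows "(M \<union> K, N \<union> K) \<in> Z_digraph U"
proof -
  note A = Z_arcD[OF arc]
  have s: "M \<subseteq> edges G\<^sub>1" "N \<subseteq> edges G\<^sub>1" "K \<subseteq> edges G\<^sub>2"
    using A(1,2) K perfect_matching_subset by auto
  have eq: "sym_diff (M \<union> K) (N \<union> K) = sym_diff M N"
    using s edges_disjoint by blast
  have "M \<inter> sym_diff M N = (M \<union> K) \<inter> sym_diff M N"
    using s edges_disjoint by blast
  then have "proper_alternating_cycle U (M \<union> K) (sym_diff M N)"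
    using A(3) proper_cycle_U proper_cycle_cong by metis
  moreover have "inside (\<Union> (sym_diff M N)) \<inter> support U = {}"
  proof -
    \<comment> \<open>The other drawing must not lie inside the cycle. The complement of a convex
      set containing the cycle lies outside it.\<close>
    have "\<Union> (sym_diff M N) \<subseteq> S\<^sub>1"
      using s in_S\<^sub>1(2) by blast
    then have "- S\<^sub>1 \<subseteq> outside (\<Union> (sym_diff M N))"
      by (intro outside_subset_convex S\<^sub>1(2))
    then have "inside (\<Union> (sym_diff M N)) \<subseteq> S\<^sub>1"
      using inside_Int_outside by blast
    then show ?thesis
      using A(4) S\<^sub>2(3) S_disjoint unfolding disjoint_union_sel by blast
  qed
  ultimately show ?thesis
    using A(1,2) K matching_U_Un(1) by (simp only: Z_digraph_iff eq simp_thms)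
qed

text \<open>A cycle is connected as a point set and cannot meet both of the disjoint open
  regions.\<close>

lemma cycle_U:
  assumes C: "proper_alternating_cycle U M C"
  shows "C \<subseteq> edges G\<^sub>1 \<or> C \<subseteq> edges G\<^sub>2"
proof -
  have sub: "C \<subseteq> edges G\<^sub>1 \<union> edges G\<^sub>2"
    using proper_cycle_subset_edges[OF C] by simp
  obtain p where "simple_path p" "path_image p = \<Union> C"
    using proper_cycle_closed_path[OF C] .
  then have "connected (\<Union> C)"
    by (metis connected_simple_path_image)
  moreover have "S\<^sub>1 \<inter> S\<^sub>2 \<inter> \<Union> C = {}" "\<Union> C \<subseteq> S\<^sub>1 \<union> S\<^sub>2"
    using S_disjoint sub in_S\<^sub>1(2) in_S\<^sub>2(2) by blast+
  ultimately have "S\<^sub>1 \<inter> \<Union> C = {} \<or> S\<^sub>2 \<inter> \<Union> C = {}"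
    using connectedD[of "\<Union> C" "S\<^sub>1" "S\<^sub>2"] S\<^sub>1(1) S\<^sub>2(1) by blast
  then show ?thesis
  proof
    assume "S\<^sub>1 \<inter> \<Union> C = {}"
    then have "e \<notin> edges G\<^sub>1" if "e \<in> C" for e
      using that in_S\<^sub>1(2)[of e] edge_nonempty[of e] by blast
    then show ?thesis
      using sub by blast
  next
    assume "S\<^sub>2 \<inter> \<Union> C = {}"
    then have "e \<notin> edges G\<^sub>2" if "e \<in> C" for e
      using that in_S\<^sub>2(2)[of e] edge_nonempty[of e] by blast
    then show ?thesis
      using sub by blast
  qed
qed

lemma arc_U_left:
  assumes arc: "(M, N) \<in> Z_digraph U" and sub: "sym_diff M N \<subseteq> edges G\<^sub>1"
  shows "(M \<inter> edges G\<^sub>1, N \<inter> edges G\<^sub>1) \<in> Z_digraph G\<^sub>1 \<and> M \<inter> edges G\<^sub>2 = N \<inter> edges G\<^sub>2"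
proof -
  note A = Z_arcD[OF arc]
  have eq: "sym_diff (M \<inter> edges G\<^sub>1) (N \<inter> edges G\<^sub>1) = sym_diff M N"
    using sub by blast
  have "M \<inter> sym_diff M N = (M \<inter> edges G\<^sub>1) \<inter> sym_diff M N"
    using sub by blast
  then have "proper_alternating_cycle G\<^sub>1 (M \<inter> edges G\<^sub>1) (sym_diff M N)"
    using A(3) sub proper_cycle_U proper_cycle_cong by metis
  moreover have "inside (\<Union> (sym_diff M N)) \<inter> support G\<^sub>1 = {}"
    using A(4) unfolding disjoint_union_sel by blast
  moreover have "M \<inter> edges G\<^sub>1 \<in> perfect_matchings G\<^sub>1" "N \<inter> edges G\<^sub>1 \<in> perfect_matchings G\<^sub>1"
    using A(1,2) matching_U by blast+
  ultimately have "(M \<inter> edges G\<^sub>1, N \<inter> edges G\<^sub>1) \<in> Z_digraph G\<^sub>1"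
    by (simp only: Z_digraph_iff eq simp_thms)
  moreover have "M \<inter> edges G\<^sub>2 = N \<inter> edges G\<^sub>2"
    using sub edges_disjoint by blast
  ultimately show ?thesis
    by blast
qed

lemma rtrancl_U_left:
  assumes "(M, N) \<in> (Z_digraph G\<^sub>1)\<^sup>*" and K: "K \<in> perfect_matchings G\<^sub>2"
  shows "(M \<union> K, N \<union> K) \<in> (Z_digraph U)\<^sup>*"
  using assms(1)
proof (induction rule: rtrancl_induct)
  case (step N N')
  then show ?case
    using arc_U[OF step(2) K] by simp
qed simp

lemma rtrancl_U:
  assumes M: "M\<^sub>1 \<in> perfect_matchings G\<^sub>1" "M\<^sub>2 \<in> perfect_matchings G\<^sub>2"
    and N: "N\<^sub>1 \<in> perfect_matchings G\<^sub>1" "N\<^sub>2 \<in> perfect_matchings G\<^sub>2"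
  shows "(M\<^sub>1 \<union> M\<^sub>2, N\<^sub>1 \<union> N\<^sub>2) \<in> (Z_digraph U)\<^sup>* \<longleftrightarrow>
    (M\<^sub>1, N\<^sub>1) \<in> (Z_digraph G\<^sub>1)\<^sup>* \<and> (M\<^sub>2, N\<^sub>2) \<in> (Z_digraph G\<^sub>2)\<^sup>*"
proof
  interpret sw: separated_graphs "G\<^sub>2" "G\<^sub>1" "S\<^sub>2" "S\<^sub>1"
    by (rule swap)
  note [simp] = disjoint_union_commute[of "G\<^sub>2" "G\<^sub>1"]
  {
    \<comment> \<open>The path first moves the component in \<open>G\<^sub>1\<close> while
      \<open>M\<^sub>2\<close> is fixed, then the one in \<open>G\<^sub>2\<close> while
      \<open>N\<^sub>1\<close> is fixed.\<close>
    assume a: "(M\<^sub>1, N\<^sub>1) \<in> (Z_digraph G\<^sub>1)\<^sup>* \<and> (M\<^sub>2, N\<^sub>2) \<in> (Z_digraph G\<^sub>2)\<^sup>*"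
    have "(M\<^sub>1 \<union> M\<^sub>2, N\<^sub>1 \<union> M\<^sub>2) \<in> (Z_digraph U)\<^sup>*"
      using a by (intro rtrancl_U_left[OF _ M(2)]) blast
    moreover have "(M\<^sub>2 \<union> N\<^sub>1, N\<^sub>2 \<union> N\<^sub>1) \<in> (Z_digraph U)\<^sup>*"
      using sw.rtrancl_U_left[OF _ N(1)] a by simp
    ultimately show "(M\<^sub>1 \<union> M\<^sub>2, N\<^sub>1 \<union> N\<^sub>2) \<in> (Z_digraph U)\<^sup>*"
      by (simp add: Un_commute)
  }
  \<comment> \<open>Conversely, every arc of the union moves just one component, so a path projects
    to a path in each graph.\<close>
  have "(M \<inter> edges G\<^sub>1, N \<inter> edges G\<^sub>1) \<in> (Z_digraph G\<^sub>1)\<^sup>* \<and>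
      (M \<inter> edges G\<^sub>2, N \<inter> edges G\<^sub>2) \<in> (Z_digraph G\<^sub>2)\<^sup>*"
    if "(M, N) \<in> (Z_digraph U)\<^sup>*" for M N
    using that
  proof (induction rule: rtrancl_induct)
    case (step N N')
    have "sym_diff N N' \<subseteq> edges G\<^sub>1 \<or> sym_diff N N' \<subseteq> edges G\<^sub>2"
      using cycle_U[OF Z_arcD(3)[OF step(2)]] .
    then have "(N \<inter> edges G\<^sub>1, N' \<inter> edges G\<^sub>1) \<in> Z_digraph G\<^sub>1 \<and> N \<inter> edges G\<^sub>2 = N' \<inter> edges G\<^sub>2 \<or>
        (N \<inter> edges G\<^sub>2, N' \<inter> edges G\<^sub>2) \<in> Z_digraph G\<^sub>2 \<and> N \<inter> edges G\<^sub>1 = N' \<inter> edges G\<^sub>1"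
      using arc_U_left[OF step(2)] sw.arc_U_left[of N N'] step(2) by auto
    then show ?case
      using step.IH by (metis rtrancl.rtrancl_into_rtrancl)
  qed simp
  moreover assume "(M\<^sub>1 \<union> M\<^sub>2, N\<^sub>1 \<union> N\<^sub>2) \<in> (Z_digraph U)\<^sup>*"
  ultimately show "(M\<^sub>1, N\<^sub>1) \<in> (Z_digraph G\<^sub>1)\<^sup>* \<and> (M\<^sub>2, N\<^sub>2) \<in> (Z_digraph G\<^sub>2)\<^sup>*"
    using matching_U_Un(2,3)[OF M] matching_U_Un(2,3)[OF N] by metis
qed

end

subsection \<open>Translations and products\<close>


lemma inside_translation:
  fixes S :: "'a::real_normed_vector set"
  shows "inside ((+) c ` S) = (+) c ` inside S"
proof -
  have *: "(+) c ` inside S \<subseteq> inside ((+) c ` S)" for c :: 'a and S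
  proof
    fix y assume "y \<in> (+) c ` inside S"
    then obtain x where x: "y = c + x" "x \<notin> S" "bounded (connected_component_set (- S) x)"
      unfolding inside_def by blast
    let ?K = "connected_component_set (- ((+) c ` S)) y"
    have nin: "y \<notin> (+) c ` S"
      using x by auto
    \<comment> \<open>Translated back, the component of \<open>y\<close> is a connected set through
      \<open>x\<close> that avoids \<open>S\<close>; so it lies in the bounded component of
      \<open>x\<close>.\<close>
    have "(+) (- c) ` ?K \<subseteq> connected_component_set (- S) x"
    proof (rule connected_component_maximal)
      show "x \<in> (+) (- c) ` ?K"
        using x(1) nin by (auto simp: image_iff intro!: exI[of _ y])
      show "connected ((+) (- c) ` ?K)"
        by (intro connected_continuous_image continuous_intros connected_connected_component)
      show "(+) (- c) ` ?K \<subseteq> - S"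
      proof clarify
        fix z assume "connected_component (- ((+) c ` S)) y z" and z: "- c + z \<in> S"
        then have "z \<notin> (+) c ` S"
          using connected_component_in by blast
        moreover have "z = c + (- c + z)"
          by simp
        ultimately show False
          using z by blast
      qed
    qed
    then have "bounded ((+) (- c) ` ?K)"
      using x(3) bounded_subset by blast
    then have "bounded ((+) c ` (+) (- c) ` ?K)"
      by (rule bounded_translation)
    then have "bounded ?K"
      by (simp add: image_image)
    then show "y \<in> inside ((+) c ` S)"
      using nin by (simp add: inside_def)
  qed
  have "(+) (- c) ` inside ((+) c ` S) \<subseteq> inside S"
    using *[of "- c" "(+) c ` S"] by (simp add: image_image)
  then have "(+) c ` (+) (- c) ` inside ((+) c ` S) \<subseteq> (+) c ` inside S"
    by (rule image_mono)
  then show ?thesis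
    using *[of c S] by (simp add: image_image)
qed

definition translate :: "complex \<Rightarrow> plane_bigraph \<Rightarrow> plane_bigraph" where
  "translate c G = \<lparr>white = (+) c ` white G, black = (+) c ` black G, edges = (`) ((+) c) ` edges G\<rparr>"

lemma translate_sel [simp]:
  "white (translate c G) = (+) c ` white G" "black (translate c G) = (+) c ` black G"
  "edges (translate c G) = (`) ((+) c) ` edges G" "verts (translate c G) = (+) c ` verts G"
  "support (translate c G) = (+) c ` support G"
  by (auto simp: translate_def verts_def support_def)

lemma translate_inverse [simp]: "translate (- c) (translate c G) = G"
  by (cases G) (simp add: translate_def image_image)

lemma translation_Int: "(+) c ` X \<inter> (+) c ` Y = (+) c ` (X \<inter> Y)" for c :: complex
  by (simp add: image_Int)

lemma plane_translate:
  assumes G: "plane_bipartite_graph G"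
  shows "plane_bipartite_graph (translate c G)"
proof -
  note P = G[unfolded plane_bipartite_graph_def]
  have inj: "(+) c ` X = (+) c ` Y \<longleftrightarrow> X = Y" for X Y :: "complex set"
    by (simp add: inj_image_eq_iff)
  show ?thesis
    unfolding plane_bipartite_graph_def translate_sel
  proof (intro conjI)
    show "\<forall>e\<in>(`) ((+) c) ` edges G. \<exists>g. arc g \<and> path_image g = e \<and>
        {pathstart g, pathfinish g} = e \<inter> (+) c ` verts G"
    proof clarify
      fix e assume e: "e \<in> edges G"
      let ?g = "(\<lambda>x. c + x) \<circ> edge_path G e"
      have "arc ?g" "path_image ?g = (+) c ` e"
        using edge_path(1,2)[OF G e] by (simp_all add: arc_translation_eq path_image_translation)
      moreover have "{pathstart ?g, pathfinish ?g} = (+) c ` {pathstart (edge_path G e), pathfinish (edge_path G e)}"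
        by (simp add: pathstart_def pathfinish_def)
      then have "{pathstart ?g, pathfinish ?g} = (+) c ` e \<inter> (+) c ` verts G"
        unfolding edge_path(5)[OF G e] translation_Int .
      ultimately show "\<exists>g. arc g \<and> path_image g = (+) c ` e \<and>
          {pathstart g, pathfinish g} = (+) c ` e \<inter> (+) c ` verts G"
        by blast
    qed
    show "\<forall>e\<in>(`) ((+) c) ` edges G. \<forall>e'\<in>(`) ((+) c) ` edges G. e \<noteq> e' \<longrightarrow>
        e \<inter> (+) c ` verts G \<noteq> e' \<inter> (+) c ` verts G \<and> e \<inter> e' \<subseteq> (+) c ` verts G"
    proof (intro ballI impI)
      fix d d' assume d: "d \<in> (`) ((+) c) ` edges G" "d' \<in> (`) ((+) c) ` edges G" "d \<noteq> d'"
      then obtain e e' where e: "e \<in> edges G" "e' \<in> edges G" "d = (+) c ` e" "d' = (+) c ` e'"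
        by blast
      then have "e \<noteq> e'"
        using d(3) by blast
      then have "e \<inter> verts G \<noteq> e' \<inter> verts G" "e \<inter> e' \<subseteq> verts G"
        using P e(1,2) by simp_all
      then show "d \<inter> (+) c ` verts G \<noteq> d' \<inter> (+) c ` verts G \<and> d \<inter> d' \<subseteq> (+) c ` verts G"
        unfolding e(3,4) translation_Int inj by blast
    qed
    show "(+) c ` white G \<inter> (+) c ` black G = {}"
      unfolding translation_Int using P by simp
    show "\<forall>e\<in>(`) ((+) c) ` edges G. e \<inter> (+) c ` white G \<noteq> {} \<and> e \<inter> (+) c ` black G \<noteq> {}"
      using P by (simp add: translation_Int)
  qed (use P in auto)
qed

lemma perfect_matchings_translate:
  assumes M: "M \<in> perfect_matchings G"
  shows "(`) ((+) c) ` M \<in> perfect_matchings (translate c G)"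
proof -
  have "\<exists>!e. e \<in> (`) ((+) c) ` M \<and> c + v \<in> e" if v: "v \<in> verts G" for v
  proof -
    obtain e where e: "e \<in> M" "v \<in> e"
      using perfect_matching_edge[OF M v] by blast
    show ?thesis
    proof (rule ex1I[of _ "(+) c ` e"])
      show "(+) c ` e \<in> (`) ((+) c) ` M \<and> c + v \<in> (+) c ` e"
        using e by blast
      fix d assume d: "d \<in> (`) ((+) c) ` M \<and> c + v \<in> d"
      then obtain e' where e': "e' \<in> M" "d = (+) c ` e'"
        by blast
      then have "v \<in> e'"
        using d by auto
      then show "d = (+) c ` e"
        using perfect_matching_unique[OF M v e(1) e'(1) e(2)] e'(2) by simp
    qed
  qed
  then show ?thesis
    using perfect_matching_subset[OF M] unfolding perfect_matchings_def by auto
qed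

lemma clockwise_translate:
  assumes "clockwise vs es" "length es = length vs" "vs \<noteq> []"
  shows "clockwise (map ((+) c) vs) (map ((`) ((+) c)) es)"
proof -
  from assms(1) obtain p where p: "simple_path p" "pathstart p = vs ! 0" "pathfinish p = vs ! 0"
    and pim: "path_image p = \<Union> (set es)"
    and tr: "\<forall>i<length vs. traverses p (es ! i) (vs ! i) (vs ! (Suc i mod length vs))"
    and wn: "\<forall>z\<in>inside (path_image p). winding_number p z = -1"
    unfolding clockwise_def by blast
  let ?q = "(\<lambda>x. c + x) \<circ> p"
  have n0: "0 < length vs"
    using assms(3) by simp
  have im: "path_image ?q = (+) c ` path_image p"
    by (simp add: path_image_translation)
  show ?thesis
    unfolding clockwise_def length_map
  proof (intro exI[of _ ?q] conjI)
    show "simple_path ?q"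
      using p(1) by (simp add: simple_path_translation_eq)
    show "pathstart ?q = map ((+) c) vs ! 0" "pathfinish ?q = map ((+) c) vs ! 0"
      using p(2,3) n0 by (simp_all add: pathstart_def pathfinish_def)
    show "path_image ?q = \<Union> (set (map ((`) ((+) c)) es))"
      unfolding im pim by auto
    show "\<forall>i<length vs. traverses ?q (map ((`) ((+) c)) es ! i) (map ((+) c) vs ! i)
        (map ((+) c) vs ! (Suc i mod length vs))"
    proof (intro allI impI)
      fix i assume i: "i < length vs"
      have "Suc i mod length vs < length vs"
        using n0 by simp
      moreover obtain s t where "0 \<le> s" "s < t" "t \<le> 1" "p ` {s..t} = es ! i" "p s = vs ! i"
        "p t = vs ! (Suc i mod length vs)"
        using tr i unfolding traverses_def by blast
      moreover from this have "?q ` {s..t} = (+) c ` (es ! i)"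
        by (simp only: image_comp[symmetric])
      ultimately show "traverses ?q (map ((`) ((+) c)) es ! i) (map ((+) c) vs ! i)
          (map ((+) c) vs ! (Suc i mod length vs))"
        unfolding traverses_def using i assms(2)
        by (intro exI[of _ s] exI[of _ t]) auto
    qed
    show "\<forall>z\<in>inside (path_image ?q). winding_number ?q z = -1"
    proof
      fix z assume "z \<in> inside (path_image ?q)"
      then obtain w where w: "w \<in> inside (path_image p)" "z = c + w"
        unfolding im inside_translation by blast
      have "winding_number ?q z = winding_number (\<lambda>t. ?q t - z) 0"
        by (rule winding_number_offset)
      also have "(\<lambda>t. ?q t - z) = (\<lambda>t. p t - w)"
        using w(2) by (simp add: o_def)
      also have "winding_number \<dots> 0 = winding_number p w"
        by (rule winding_number_offset[symmetric])
      finally show "winding_number ?q z = -1"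
        using wn w(1) by metis
    qed
  qed
qed

lemma proper_cycle_translate:
  assumes "proper_alternating_cycle G M C"
  shows "proper_alternating_cycle (translate c G) ((`) ((+) c) ` M) ((`) ((+) c) ` C)"
proof -
  from assms obtain vs es where cyc: "is_cycle G vs es" and cl: "clockwise vs es" and C_eq: "set es = C"
    and alt: "alternating M es"
    and wb: "\<forall>i<length vs. es ! i \<in> M \<longrightarrow> vs ! i \<in> white G \<and> vs ! (Suc i mod length vs) \<in> black G"
    unfolding proper_alternating_cycle_def by blast
  let ?vs = "map ((+) c) vs" and ?es = "map ((`) ((+) c)) es"
  have les: "length es = length vs" and n: "3 \<le> length vs"
    and ends: "\<forall>i<length vs. es ! i \<inter> verts G = {vs ! i, vs ! (Suc i mod length vs)}"
    using cyc unfolding is_cycle_def by auto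
  have j: "Suc i mod length vs < length vs" for i
    using n by (intro mod_less_divisor) linarith
  have mem: "(+) c ` e \<in> (`) ((+) c) ` M \<longleftrightarrow> e \<in> M" for e
    by (simp add: inj_image_mem_iff inj_image_eq_iff inj_def)
  have vs: "?vs ! i = c + vs ! i" and es: "?es ! i = (+) c ` (es ! i)" if "i < length vs" for i
    using that les by simp_all
  have "is_cycle (translate c G) ?vs ?es"
  proof -
    have "?es ! i \<inter> (+) c ` verts G = {?vs ! i, ?vs ! (Suc i mod length vs)}" if i: "i < length vs" for i
      unfolding es[OF i] vs[OF i] vs[OF j] translation_Int using ends i by simp
    then show ?thesis
      using cyc unfolding is_cycle_def by (auto simp: distinct_map)
  qed
  moreover have "clockwise ?vs ?es"
    using n by (intro clockwise_translate[OF cl les]) auto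
  moreover have "set ?es = (`) ((+) c) ` C"
    using C_eq by simp
  moreover have "alternating ((`) ((+) c) ` M) ?es"
    unfolding alternating_def length_map les
  proof (intro allI impI)
    fix i assume i: "i < length vs"
    show "?es ! i \<in> (`) ((+) c) ` M \<longleftrightarrow> ?es ! (Suc i mod length vs) \<notin> (`) ((+) c) ` M"
      unfolding es[OF i] es[OF j] mem using alt i unfolding alternating_def les by blast
  qed
  moreover have "\<forall>i<length ?vs. ?es ! i \<in> (`) ((+) c) ` M \<longrightarrow>
      ?vs ! i \<in> white (translate c G) \<and> ?vs ! (Suc i mod length ?vs) \<in> black (translate c G)"
    unfolding length_map
  proof (intro allI impI)
    fix i assume i: "i < length vs" and M: "?es ! i \<in> (`) ((+) c) ` M"
    have "vs ! i \<in> white G \<and> vs ! (Suc i mod length vs) \<in> black G"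
      using wb i M unfolding es[OF i] mem by blast
    then show "?vs ! i \<in> white (translate c G) \<and> ?vs ! (Suc i mod length vs) \<in> black (translate c G)"
      unfolding vs[OF i] vs[OF j] translate_sel by blast
  qed
  ultimately show ?thesis
    unfolding proper_alternating_cycle_def by blast
qed

lemma Z_digraph_translate:
  assumes arc: "(M, N) \<in> Z_digraph G"
  shows "((`) ((+) c) ` M, (`) ((+) c) ` N) \<in> Z_digraph (translate c G)"
proof -
  let ?T = "(`) ((+) c)"
  note A = Z_arcD[OF arc]
  have "inj ?T"
    by (simp add: inj_def inj_image_eq_iff)
  then have eq: "sym_diff (?T ` M) (?T ` N) = ?T ` sym_diff M N"
    by (simp add: image_Un image_set_diff)
  have un: "\<Union> (?T ` sym_diff M N) = (+) c ` \<Union> (sym_diff M N)"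
    by blast
  have "inside (\<Union> (?T ` sym_diff M N)) \<inter> support (translate c G) = {}"
    unfolding un inside_translation translate_sel translation_Int A(4) by simp
  then show ?thesis
    unfolding Z_digraph_iff eq
    using perfect_matchings_translate[OF A(1)] perfect_matchings_translate[OF A(2)]
      proper_cycle_translate[OF A(3)] by blast
qed

lemma Z_rtrancl_translate:
  assumes "(M, N) \<in> (Z_digraph G)\<^sup>*"
  shows "((`) ((+) c) ` M, (`) ((+) c) ` N) \<in> (Z_digraph (translate c G))\<^sup>*"
  using assms
proof (induction rule: rtrancl_induct)
  case (step N N')
  then show ?case
    using Z_digraph_translate[OF step(2), of c] by (meson rtrancl.rtrancl_into_rtrancl)
qed simp

section \<open>Order isomorphisms and binary products\<close>

lemma order_isomorphicI:
  assumes "bij_betw \<phi> (carrier P) (carrier Q)"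
    and "\<And>x y. x \<in> carrier P \<Longrightarrow> y \<in> carrier P \<Longrightarrow> x \<sqsubseteq>\<^bsub>P\<^esub> y \<longleftrightarrow> \<phi> x \<sqsubseteq>\<^bsub>Q\<^esub> \<phi> y"
  shows "order_isomorphic P Q"
  using assms unfolding order_isomorphic_def by blast

lemma order_isomorphic_sym:
  assumes "order_isomorphic P Q"
  shows "order_isomorphic Q P"
proof -
  obtain \<phi> where \<phi>: "bij_betw \<phi> (carrier P) (carrier Q)"
    "\<forall>x\<in>carrier P. \<forall>y\<in>carrier P. x \<sqsubseteq>\<^bsub>P\<^esub> y \<longleftrightarrow> \<phi> x \<sqsubseteq>\<^bsub>Q\<^esub> \<phi> y"
    using assms unfolding order_isomorphic_def by blast
  let ?\<psi> = "inv_into (carrier P) \<phi>"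
  show ?thesis
  proof (rule order_isomorphicI)
    show "bij_betw ?\<psi> (carrier Q) (carrier P)"
      using \<phi>(1) by (rule bij_betw_inv_into)
    fix x y assume xy: "x \<in> carrier Q" "y \<in> carrier Q"
    then have "?\<psi> x \<in> carrier P" "?\<psi> y \<in> carrier P" "\<phi> (?\<psi> x) = x" "\<phi> (?\<psi> y) = y"
      using \<phi>(1) by (auto simp: bij_betw_def inv_into_into f_inv_into_f)
    then show "x \<sqsubseteq>\<^bsub>Q\<^esub> y \<longleftrightarrow> ?\<psi> x \<sqsubseteq>\<^bsub>P\<^esub> ?\<psi> y"
      using \<phi>(2) by simp
  qed
qed

lemma order_isomorphic_trans:
  assumes "order_isomorphic P Q" "order_isomorphic Q R"
  shows "order_isomorphic P R"
proof -
  obtain \<phi> where \<phi>: "bij_betw \<phi> (carrier P) (carrier Q)"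
    "\<forall>x\<in>carrier P. \<forall>y\<in>carrier P. x \<sqsubseteq>\<^bsub>P\<^esub> y \<longleftrightarrow> \<phi> x \<sqsubseteq>\<^bsub>Q\<^esub> \<phi> y"
    using assms(1) unfolding order_isomorphic_def by blast
  obtain \<psi> where \<psi>: "bij_betw \<psi> (carrier Q) (carrier R)"
    "\<forall>x\<in>carrier Q. \<forall>y\<in>carrier Q. x \<sqsubseteq>\<^bsub>Q\<^esub> y \<longleftrightarrow> \<psi> x \<sqsubseteq>\<^bsub>R\<^esub> \<psi> y"
    using assms(2) unfolding order_isomorphic_def by blast
  show ?thesis
  proof (rule order_isomorphicI)
    show "bij_betw (\<psi> \<circ> \<phi>) (carrier P) (carrier R)"
      using \<phi>(1) \<psi>(1) by (rule bij_betw_trans)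
    fix x y assume xy: "x \<in> carrier P" "y \<in> carrier P"
    then have "\<phi> x \<in> carrier Q" "\<phi> y \<in> carrier Q"
      using \<phi>(1) bij_betwE by blast+
    then show "x \<sqsubseteq>\<^bsub>P\<^esub> y \<longleftrightarrow> (\<psi> \<circ> \<phi>) x \<sqsubseteq>\<^bsub>R\<^esub> (\<psi> \<circ> \<phi>) y"
      using \<phi>(2) \<psi>(2) xy by simp
  qed
qed

lemma matching_poset_sel [simp]:
  "carrier (matching_poset G) = perfect_matchings G"
  "M \<sqsubseteq>\<^bsub>matching_poset G\<^esub> N \<longleftrightarrow> (N, M) \<in> (Z_digraph G)\<^sup>*"
  by (simp_all add: matching_poset_def)

lemma matching_poset_translate:
  "order_isomorphic (matching_poset G) (matching_poset (translate c G))"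
proof (rule order_isomorphicI)
  let ?T = "\<lambda>c :: complex. (`) ((`) ((+) c)) :: complex set set \<Rightarrow> complex set set"
  have cancel: "?T (- c) (?T c M) = M" "?T c (?T (- c) M) = M" for M
    by (simp_all add: image_image)
  have backward: "N \<in> perfect_matchings (translate c G) \<Longrightarrow> ?T (- c) N \<in> perfect_matchings G" for N
    using perfect_matchings_translate[of N "translate c G" "- c"] by simp
  show "bij_betw (?T c) (carrier (matching_poset G)) (carrier (matching_poset (translate c G)))"
    unfolding matching_poset_sel
    by (rule bij_betw_byWitness[where f' = "?T (- c)"])
      (use cancel backward perfect_matchings_translate in auto)
  fix M N
  show "M \<sqsubseteq>\<^bsub>matching_poset G\<^esub> N \<longleftrightarrow> ?T c M \<sqsubseteq>\<^bsub>matching_poset (translate c G)\<^esub> ?T c N"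
    \<comment> \<open>Paths are only shown to be carried forwards; the converse is the translation
      by \<open>- c\<close>.\<close>
    using Z_rtrancl_translate[of N M G c]
      Z_rtrancl_translate[of "?T c N" "?T c M" "translate c G" "- c"] cancel
    by auto
qed

text \<open>Binary products serve both directions of the theorem:
  \<open>product_order_insert\<close> peels off one factor, either for an induction or to set it
  against the product of all the others.\<close>

definition pair_order :: "'a gorder \<Rightarrow> 'b gorder \<Rightarrow> ('a \<times> 'b) gorder" where
  "pair_order P Q = \<lparr>carrier = carrier P \<times> carrier Q, eq = (=),
     le = (\<lambda>x y. fst x \<sqsubseteq>\<^bsub>P\<^esub> fst y \<and> snd x \<sqsubseteq>\<^bsub>Q\<^esub> snd y)\<rparr>"

lemma pair_order_sel [simp]:
  "carrier (pair_order P Q) = carrier P \<times> carrier Q"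
  "x \<sqsubseteq>\<^bsub>pair_order P Q\<^esub> y \<longleftrightarrow> fst x \<sqsubseteq>\<^bsub>P\<^esub> fst y \<and> snd x \<sqsubseteq>\<^bsub>Q\<^esub> snd y"
  by (simp_all add: pair_order_def)

lemma product_order_sel [simp]:
  "carrier (product_order I P) = (\<Pi>\<^sub>E i\<in>I. carrier (P i))"
  "x \<sqsubseteq>\<^bsub>product_order I P\<^esub> y \<longleftrightarrow> (\<forall>i\<in>I. x i \<sqsubseteq>\<^bsub>P i\<^esub> y i)"
  by (simp_all add: product_order_def)

lemma pair_order_cong:
  assumes "order_isomorphic P P'" "order_isomorphic Q Q'"
  shows "order_isomorphic (pair_order P Q) (pair_order P' Q')"
proof -
  obtain \<phi> where \<phi>: "bij_betw \<phi> (carrier P) (carrier P')"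
    "\<forall>x\<in>carrier P. \<forall>y\<in>carrier P. x \<sqsubseteq>\<^bsub>P\<^esub> y \<longleftrightarrow> \<phi> x \<sqsubseteq>\<^bsub>P'\<^esub> \<phi> y"
    using assms(1) unfolding order_isomorphic_def by blast
  obtain \<psi> where \<psi>: "bij_betw \<psi> (carrier Q) (carrier Q')"
    "\<forall>x\<in>carrier Q. \<forall>y\<in>carrier Q. x \<sqsubseteq>\<^bsub>Q\<^esub> y \<longleftrightarrow> \<psi> x \<sqsubseteq>\<^bsub>Q'\<^esub> \<psi> y"
    using assms(2) unfolding order_isomorphic_def by blast
  show ?thesis
  proof (rule order_isomorphicI)
    show "bij_betw (map_prod \<phi> \<psi>) (carrier (pair_order P Q)) (carrier (pair_order P' Q'))"
      using bij_betw_map_prod[OF \<phi>(1) \<psi>(1)] by simp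
    fix x y assume "x \<in> carrier (pair_order P Q)" "y \<in> carrier (pair_order P Q)"
    then show "x \<sqsubseteq>\<^bsub>pair_order P Q\<^esub> y \<longleftrightarrow> map_prod \<phi> \<psi> x \<sqsubseteq>\<^bsub>pair_order P' Q'\<^esub> map_prod \<phi> \<psi> y"
      using \<phi>(2) \<psi>(2) by auto
  qed
qed

lemma product_order_insert:
  assumes i: "i \<notin> I"
  shows "order_isomorphic (pair_order (P i) (product_order I P)) (product_order (insert i I) P)"
proof (rule order_isomorphicI[where \<phi> = "\<lambda>(a, x). x(i := a)"])
  show "bij_betw (\<lambda>(a, x). x(i := a)) (carrier (pair_order (P i) (product_order I P)))
      (carrier (product_order (insert i I) P))"
    using inj_combinator[OF i, of "\<lambda>i. carrier (P i)"] by (simp add: bij_betw_def PiE_insert_eq)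
  fix x y
  show "x \<sqsubseteq>\<^bsub>pair_order (P i) (product_order I P)\<^esub> y \<longleftrightarrow>
      (\<lambda>(a, x). x(i := a)) x \<sqsubseteq>\<^bsub>product_order (insert i I) P\<^esub> (\<lambda>(a, x). x(i := a)) y"
    using i by (cases x; cases y) auto
qed

lemma (in separated_graphs) matching_poset_U:
  "order_isomorphic (pair_order (matching_poset G\<^sub>1) (matching_poset G\<^sub>2)) (matching_poset U)"
proof (rule order_isomorphicI[where \<phi> = "\<lambda>(M\<^sub>1, M\<^sub>2). M\<^sub>1 \<union> M\<^sub>2"])
  show "bij_betw (\<lambda>(M\<^sub>1, M\<^sub>2). M\<^sub>1 \<union> M\<^sub>2) (carrier (pair_order (matching_poset G\<^sub>1) (matching_poset G\<^sub>2)))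
      (carrier (matching_poset U))"
    unfolding pair_order_sel matching_poset_sel
  proof (rule bij_betw_byWitness[where f' = "\<lambda>M. (M \<inter> edges G\<^sub>1, M \<inter> edges G\<^sub>2)"])
    show "\<forall>M\<in>perfect_matchings G\<^sub>1 \<times> perfect_matchings G\<^sub>2.
        (\<lambda>M. (M \<inter> edges G\<^sub>1, M \<inter> edges G\<^sub>2)) ((\<lambda>(M\<^sub>1, M\<^sub>2). M\<^sub>1 \<union> M\<^sub>2) M) = M"
      using matching_U_Un(2,3) by auto
    show "\<forall>M\<in>perfect_matchings U. (\<lambda>(M\<^sub>1, M\<^sub>2). M\<^sub>1 \<union> M\<^sub>2) (M \<inter> edges G\<^sub>1, M \<inter> edges G\<^sub>2) = M"
      using matching_U by auto
    show "(\<lambda>(M\<^sub>1, M\<^sub>2). M\<^sub>1 \<union> M\<^sub>2) ` (perfect_matchings G\<^sub>1 \<times> perfect_matchings G\<^sub>2) \<subseteq> perfect_matchings U"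
      using matching_U_Un(1) by auto
    show "(\<lambda>M. (M \<inter> edges G\<^sub>1, M \<inter> edges G\<^sub>2)) ` perfect_matchings U \<subseteq>
        perfect_matchings G\<^sub>1 \<times> perfect_matchings G\<^sub>2"
      using matching_U by auto
  qed
  fix x y assume "x \<in> carrier (pair_order (matching_poset G\<^sub>1) (matching_poset G\<^sub>2))"
    "y \<in> carrier (pair_order (matching_poset G\<^sub>1) (matching_poset G\<^sub>2))"
  then show "x \<sqsubseteq>\<^bsub>pair_order (matching_poset G\<^sub>1) (matching_poset G\<^sub>2)\<^esub> y \<longleftrightarrow>
      (\<lambda>(M\<^sub>1, M\<^sub>2). M\<^sub>1 \<union> M\<^sub>2) x \<sqsubseteq>\<^bsub>matching_poset U\<^esub> (\<lambda>(M\<^sub>1, M\<^sub>2). M\<^sub>1 \<union> M\<^sub>2) y"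
    by (cases x; cases y) (simp add: rtrancl_U)
qed

section \<open>Realising products and factors by graphs\<close>

lemma bounded_support:
  assumes G: "plane_bipartite_graph G"
  shows "bounded (support G)"
proof -
  have "bounded e" if "e \<in> edges G" for e
    using edge_path(1,2)[OF G that] bounded_path_image arc_imp_path by metis
  then show ?thesis
    using G unfolding support_def plane_bipartite_graph_def by (simp add: finite_imp_bounded bounded_Union)
qed

lemma matching_posets_product:
  assumes G: "plane_bipartite_graph G\<^sub>1" "plane_bipartite_graph G\<^sub>2"
    and ne: "perfect_matchings G\<^sub>1 \<noteq> {}" "perfect_matchings G\<^sub>2 \<noteq> {}"
  shows "\<exists>G. plane_bipartite_graph G \<and>
    order_isomorphic (pair_order (matching_poset G\<^sub>1) (matching_poset G\<^sub>2)) (matching_poset G)"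
proof -
  obtain r\<^sub>1 r\<^sub>2 where r: "support G\<^sub>1 \<subseteq> ball 0 r\<^sub>1" "support G\<^sub>2 \<subseteq> ball 0 r\<^sub>2"
    using bounded_subset_ballD[OF bounded_support[OF G(1)], of 0]
      bounded_subset_ballD[OF bounded_support[OF G(2)], of 0] by blast
  define r where "r = max 0 (max r\<^sub>1 r\<^sub>2)"
  \<comment> \<open>Both drawings fit into a ball of radius \<open>r\<close> around 0. Open balls of
    this radius with centres \<open>2 * r\<close> apart are disjoint.\<close>
  define c where "c = complex_of_real (2 * r)"
  have sub: "support G\<^sub>1 \<subseteq> ball 0 r" "support G\<^sub>2 \<subseteq> ball 0 r"
    using r unfolding r_def by (auto simp: subset_iff)
  let ?G = "translate c G\<^sub>2"
  obtain M where M: "M \<in> perfect_matchings G\<^sub>2"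
    using ne(2) by blast
  interpret separated_graphs "G\<^sub>1" ?G "ball 0 r" "ball c r"
  proof
    show "perfect_matchings ?G \<noteq> {}"
      using perfect_matchings_translate[OF M] by blast
    show "support ?G \<subseteq> ball c r"
      using sub(2) by (auto simp: dist_norm)
    show "ball 0 r \<inter> ball c r = {}"
    proof (rule disjoint_ballI)
      show "r + r \<le> dist 0 c"
        by (simp add: c_def)
    qed
  qed (use G ne sub plane_translate in auto)
  have "order_isomorphic (matching_poset G\<^sub>1) (matching_poset G\<^sub>1)"
    by (rule order_isomorphicI[where \<phi> = id]) auto
  then show ?thesis
    using plane_U matching_poset_U
      order_isomorphic_trans[OF pair_order_cong[OF _ matching_poset_translate]] by metis
qed

lemma matching_poset_factor:
  assumes G: "plane_bipartite_graph G" and iso: "order_isomorphic (pair_order P Q) (matching_poset G)"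
    and p: "p \<in> carrier P" "\<forall>x\<in>carrier P. p \<sqsubseteq>\<^bsub>P\<^esub> x" and q: "q \<in> carrier Q" "\<forall>x\<in>carrier Q. q \<sqsubseteq>\<^bsub>Q\<^esub> x"
    and join: "\<forall>x\<in>carrier P. \<forall>y\<in>carrier P. \<exists>j\<in>carrier P. x \<sqsubseteq>\<^bsub>P\<^esub> j \<and> y \<sqsubseteq>\<^bsub>P\<^esub> j \<and>
      (\<forall>z\<in>carrier P. x \<sqsubseteq>\<^bsub>P\<^esub> z \<longrightarrow> y \<sqsubseteq>\<^bsub>P\<^esub> z \<longrightarrow> j \<sqsubseteq>\<^bsub>P\<^esub> z)"
  shows "\<exists>H. plane_bipartite_graph H \<and> order_isomorphic P (matching_poset H)"
proof -
  obtain \<phi> where \<phi>: "bij_betw \<phi> (carrier P \<times> carrier Q) (perfect_matchings G)"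
    "\<forall>x\<in>carrier P \<times> carrier Q. \<forall>y\<in>carrier P \<times> carrier Q.
       fst x \<sqsubseteq>\<^bsub>P\<^esub> fst y \<and> snd x \<sqsubseteq>\<^bsub>Q\<^esub> snd y \<longleftrightarrow> (\<phi> y, \<phi> x) \<in> (Z_digraph G)\<^sup>*"
    using iso unfolding order_isomorphic_def pair_order_sel matching_poset_sel by blast
  interpret matching_product_join G "carrier P" "le P" p "carrier Q" "le Q" q "\<lambda>a b. \<phi> (a, b)"
  proof
    show "plane_bipartite_graph G"
      by (rule G)
    show "\<phi> (a, b) \<in> perfect_matchings G" if "a \<in> carrier P" "b \<in> carrier Q" for a b
      using \<phi>(1) that by (auto dest: bij_betwE)
    show "\<exists>a\<in>carrier P. \<exists>b\<in>carrier Q. M = \<phi> (a, b)" if "M \<in> perfect_matchings G" for M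
      using \<phi>(1) that unfolding bij_betw_def by blast
    show "a = a' \<and> b = b'" if "a \<in> carrier P" "a' \<in> carrier P" "b \<in> carrier Q" "b' \<in> carrier Q"
      "\<phi> (a, b) = \<phi> (a', b')" for a a' b b'
      using inj_onD[OF bij_betw_imp_inj_on[OF \<phi>(1)] that(5)] that by simp
    show "(\<phi> (a, b), \<phi> (a', b')) \<in> (Z_digraph G)\<^sup>* \<longleftrightarrow> a' \<sqsubseteq>\<^bsub>P\<^esub> a \<and> b' \<sqsubseteq>\<^bsub>Q\<^esub> b"
      if "a \<in> carrier P" "a' \<in> carrier P" "b \<in> carrier Q" "b' \<in> carrier Q" for a a' b b'
      using \<phi>(2) that by auto
  qed (use p q join in auto)
  have "order_isomorphic P (matching_poset H)"
  proof (rule order_isomorphicI)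
    show "bij_betw \<psi> (carrier P) (carrier (matching_poset H))"
      unfolding bij_betw_def matching_poset_sel
    proof
      show "inj_on \<psi> (carrier P)"
        using \<psi>_inj by (rule inj_onI)
      show "\<psi> ` carrier P = perfect_matchings H"
        using \<psi>_matching \<psi>_surj by blast
    qed
    show "x \<sqsubseteq>\<^bsub>P\<^esub> y \<longleftrightarrow> \<psi> x \<sqsubseteq>\<^bsub>matching_poset H\<^esub> \<psi> y" if "x \<in> carrier P" "y \<in> carrier P" for x y
      using \<psi>_le[OF that(2,1)] by simp
  qed
  then show ?thesis
    using plane_H by blast
qed

section \<open>Finite products of lattices\<close>

lemma (in finite_distributive_lattice) bottom_exists:
  "\<exists>b\<in>carrier L. \<forall>x\<in>carrier L. b \<sqsubseteq> x"
proof -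
  have "greatest L (\<Sqinter> (carrier L)) (Lower L (carrier L))"
    using finite_carrier carrier_nonempty by (intro finite_inf_greatest) auto
  then show ?thesis
    unfolding greatest_def Lower_def by blast
qed

lemma (in finite_distributive_lattice) join_exists:
  "x \<in> carrier L \<Longrightarrow> y \<in> carrier L \<Longrightarrow>
     \<exists>j\<in>carrier L. x \<sqsubseteq> j \<and> y \<sqsubseteq> j \<and> (\<forall>z\<in>carrier L. x \<sqsubseteq> z \<longrightarrow> y \<sqsubseteq> z \<longrightarrow> j \<sqsubseteq> z)"
  using join_left join_right join_le join_closed by meson

text \<open>The empty product has one element, and the empty graph has one perfect matching, the
  empty one.\<close>

lemma matching_poset_empty:
  "\<exists>G. plane_bipartite_graph G \<and> order_isomorphic (product_order {} P) (matching_poset G)"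
proof -
  let ?G = "\<lparr>white = {}, black = {}, edges = {}\<rparr> :: plane_bigraph"
  have pm: "perfect_matchings ?G = {{}}"
    by (auto simp: perfect_matchings_def verts_def)
  have "order_isomorphic (product_order {} P) (matching_poset ?G)"
    by (rule order_isomorphicI[where \<phi> = "\<lambda>_. {}"]) (auto simp: pm bij_betw_def)
  moreover have "plane_bipartite_graph ?G"
    by (simp add: plane_bipartite_graph_def verts_def)
  ultimately show ?thesis
    by blast
qed

lemma order_isomorphic_nonempty:
  "order_isomorphic P Q \<Longrightarrow> carrier P \<noteq> {} \<Longrightarrow> carrier Q \<noteq> {}"
  unfolding order_isomorphic_def by (metis bij_betw_empty2 bij_betw_def image_is_empty)

lemma product_order_matchable:
  assumes "finite I" and "\<And>i. i \<in> I \<Longrightarrow> matchable_distributive_lattice (P i)"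
  shows "\<exists>G. plane_bipartite_graph G \<and> order_isomorphic (product_order I P) (matching_poset G)"
  using assms
proof (induction rule: finite_induct)
  case empty
  show ?case by (rule matching_poset_empty)
next
  case (insert i I)
  have ne: "carrier (P j) \<noteq> {}" if "j \<in> insert i I" for j
    using insert.prems[OF that] finite_distributive_lattice.carrier_nonempty
    unfolding matchable_distributive_lattice_def by blast
  obtain G\<^sub>1 where G\<^sub>1: "plane_bipartite_graph G\<^sub>1" "order_isomorphic (P i) (matching_poset G\<^sub>1)"
    using insert.prems unfolding matchable_distributive_lattice_def by blast
  obtain G\<^sub>2 where G\<^sub>2: "plane_bipartite_graph G\<^sub>2" "order_isomorphic (product_order I P) (matching_poset G\<^sub>2)"
    using insert.IH insert.prems by blast
  \<comment> \<open>Nonempty carriers give both graphs a perfect matching, as required for drawing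
    them side by side.\<close>
  have "carrier (product_order I P) \<noteq> {}"
    using ne by (simp add: PiE_eq_empty_iff)
  then have "perfect_matchings G\<^sub>1 \<noteq> {}" "perfect_matchings G\<^sub>2 \<noteq> {}"
    using order_isomorphic_nonempty[OF G\<^sub>1(2)] order_isomorphic_nonempty[OF G\<^sub>2(2)] ne by auto
  then obtain G where G: "plane_bipartite_graph G"
    "order_isomorphic (pair_order (matching_poset G\<^sub>1) (matching_poset G\<^sub>2)) (matching_poset G)"
    using matching_posets_product[OF G\<^sub>1(1) G\<^sub>2(1)] by blast
  have "order_isomorphic (product_order (insert i I) P) (pair_order (P i) (product_order I P))"
    using order_isomorphic_sym[OF product_order_insert[OF insert.hyps(2)]] .
  then have "order_isomorphic (product_order (insert i I) P) (matching_poset G)"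
    using order_isomorphic_trans order_isomorphic_trans[OF pair_order_cong[OF G\<^sub>1(2) G\<^sub>2(2)] G(2)] by metis
  then show ?case
    using G(1) by blast
qed

theorem theorem3p8:
  fixes L :: "'a gorder" and Ls :: "nat \<Rightarrow> 'b gorder" and n :: nat
  assumes "finite_distributive_lattice L"
    and "\<And>i. i \<in> {1..n} \<Longrightarrow> finite_distributive_lattice (Ls i)"
    and "order_isomorphic L (product_order {1..n} Ls)"
  shows "matchable_distributive_lattice L \<longleftrightarrow>
         (\<forall>i\<in>{1..n}. matchable_distributive_lattice (Ls i))"
proof
  assume "matchable_distributive_lattice L"
  then obtain G where G: "plane_bipartite_graph G" "order_isomorphic L (matching_poset G)"
    unfolding matchable_distributive_lattice_def by blast
  show "\<forall>i\<in>{1..n}. matchable_distributive_lattice (Ls i)"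
  proof
    fix i assume i: "i \<in> {1..n}"
    \<comment> \<open>All factors other than \<open>Ls i\<close> are collected into the second
      component of a binary product.\<close>
    define I where "I = {1..n} - {i}"
    have I: "{1..n} = insert i I" "i \<notin> I"
      using i by (auto simp: I_def)
    have "order_isomorphic (pair_order (Ls i) (product_order I Ls)) L"
      using product_order_insert[OF I(2), of Ls] order_isomorphic_sym[OF assms(3)] I(1)
        order_isomorphic_trans by metis
    then have iso: "order_isomorphic (pair_order (Ls i) (product_order I Ls)) (matching_poset G)"
      using G(2) order_isomorphic_trans by metis
    have "\<forall>j\<in>{1..n}. \<exists>b\<in>carrier (Ls j). \<forall>x\<in>carrier (Ls j). b \<sqsubseteq>\<^bsub>Ls j\<^esub> x"
      using finite_distributive_lattice.bottom_exists[OF assms(2)] by blast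
    then obtain b where b: "\<forall>j\<in>{1..n}. b j \<in> carrier (Ls j) \<and> (\<forall>x\<in>carrier (Ls j). b j \<sqsubseteq>\<^bsub>Ls j\<^esub> x)"
      by metis
    have "\<exists>H. plane_bipartite_graph H \<and> order_isomorphic (Ls i) (matching_poset H)"
    proof (rule matching_poset_factor[OF G(1) iso])
      show "b i \<in> carrier (Ls i)" "\<forall>x\<in>carrier (Ls i). b i \<sqsubseteq>\<^bsub>Ls i\<^esub> x"
        using b i by blast+
      \<comment> \<open>The least element of the remaining product takes the bottom of each factor;
        \<open>restrict\<close> makes it extensional, as membership in the carrier demands.\<close>
      show "restrict b I \<in> carrier (product_order I Ls)"
        "\<forall>x\<in>carrier (product_order I Ls). restrict b I \<sqsubseteq>\<^bsub>product_order I Ls\<^esub> x"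
        using b by (auto simp: I_def PiE_iff)
      show "\<forall>x\<in>carrier (Ls i). \<forall>y\<in>carrier (Ls i). \<exists>j\<in>carrier (Ls i). x \<sqsubseteq>\<^bsub>Ls i\<^esub> j \<and> y \<sqsubseteq>\<^bsub>Ls i\<^esub> j \<and>
          (\<forall>z\<in>carrier (Ls i). x \<sqsubseteq>\<^bsub>Ls i\<^esub> z \<longrightarrow> y \<sqsubseteq>\<^bsub>Ls i\<^esub> z \<longrightarrow> j \<sqsubseteq>\<^bsub>Ls i\<^esub> z)"
        using finite_distributive_lattice.join_exists[OF assms(2)[OF i]] by blast
    qed
    then show "matchable_distributive_lattice (Ls i)"
      using assms(2)[OF i] unfolding matchable_distributive_lattice_def by blast
  qed
next
  assume "\<forall>i\<in>{1..n}. matchable_distributive_lattice (Ls i)"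
  then obtain G where "plane_bipartite_graph G"
    "order_isomorphic (product_order {1..n} Ls) (matching_poset G)"
    using product_order_matchable[of "{1..n}" Ls] by auto
  then show "matchable_distributive_lattice L"
    using assms(1) order_isomorphic_trans[OF assms(3)]
    unfolding matchable_distributive_lattice_def by blast
qed

end
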